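(* Let $\triangle PQR$ be a (closed, filled) triangle contained in $D$ such that either $\Delta_2'(P,Q)\leq \delta(P,Q,R)\leq \tfrac{1}{2}\Delta_1'(P,Q)$ or $\tfrac{1}{2}\Delta_1'(P,Q)\leq \delta(P,Q,R)\leq \Delta_2'(P,Q)$. Then $\rho(\psi_{\triangle PQR})=\tfrac{2}{5}$.
   Context: $D=\{(x,y)\in\mathbb R^2: x^2+y^2<1\}$ is the open unit disk and $S^1$ its boundary circle, identified with $\mathbb R/\mathbb Z$ via the counterclockwise normalized angle; $\pi:\mathbb R\to S^1$ is the projection $x\mapsto x-\lfloor x\rfloor$. For a closed convex set $U\subset D$ and $v\in S^1$, $\psi_U(v)$ is the point $w\in S^1\setminus\{v\}$ such that the line $vw$ meets $U$ and $U$ lies in the closed half-plane to the left of the directed line from $v$ to $w$ (equivalently, among the points $w$ with chord $vw$ tangent to $U$, the one reached first going counterclockwise from $v$). $\psi_U$ is an orientation-preserving homeomorphism of $S^1$. For an orientation-preserving homeomorphism $f$ of $S^1$, $\rho(f)=\lim_{n\to\infty}(\overline f^n(x)-x)/n$ where $\overline f$ is the lift of $f$ to $\mathbb R$ with $\overline f(0)\in[0,1)$. Regard $D$ as the Beltrami–Klein model of the hyperbolic plane: hyperbolic lines are chords of $D$. For distinct $P,Q\in D$, let $v_1,v_2\in S^1$ be the endpoints of the chord through $P,Q$; define $d'(P,Q)=\tfrac12\left|\log\frac{|v_1Q||v_2P|}{|v_1P||v_2Q|}\right|$ (Euclidean lengths), and $d'(P,P)=0$. For $n\in\mathbb Z_{>0}$,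 $\Delta_n'(P,Q)=\log\frac{e^{n d'(P,Q)}+1}{e^{n d'(P,Q)}-1}$. For $P\neq Q$ and $R$ in $D$, $\delta(P,Q,R)$ is the minimum of $d'(R,S)$ over points $S$ of the chord (hyperbolic line) through $P$ and $Q$. *)

theory Defs
  imports "HOL-Analysis.Analysis"
begin

text \<open>The plane is modelled by the complex numbers; D = ball 0 1, S^1 = sphere 0 1,
  and t in R corresponds to the point cis (2 pi t) (counterclockwise normalized angle).\<close>

text \<open>Signed cross product: positive iff z lies strictly to the left of the
  directed line from v to w.\<close>
definition cross :: "complex \<Rightarrow> complex \<Rightarrow> complex \<Rightarrow> real" where
  "cross v w z = Im (cnj (w - v) * (z - v))"

definition psi :: "complex set \<Rightarrow> complex \<Rightarrow> complex" where
  "psi U v = (THE w. norm w = 1 \<and> w \<noteq> v \<and> (\<exists>z\<in>U. cross v w z = 0)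
                      \<and> (\<forall>z\<in>U. 0 \<le> cross v w z))"

definition circle_lift :: "(complex \<Rightarrow> complex) \<Rightarrow> real \<Rightarrow> real" where
  "circle_lift f = (THE F. continuous_on UNIV F \<and> F 0 \<in> {0..<1}
                       \<and> (\<forall>x. f (cis (2 * pi * x)) = cis (2 * pi * F x)))"

definition chord_ends :: "complex \<Rightarrow> complex \<Rightarrow> complex \<times> complex" where
  "chord_ends P Q = (SOME (v1, v2). v1 \<noteq> v2 \<and> norm v1 = 1 \<and> norm v2 = 1
                         \<and> cross P Q v1 = 0 \<and> cross P Q v2 = 0)"

definition hdist :: "complex \<Rightarrow> complex \<Rightarrow> real" where
  "hdist P Q = (if P = Q then 0 else
     (case chord_ends P Q of (v1, v2) \<Rightarrow>
        (1/2) * \<bar>ln ((norm (Q - v1) * norm (P - v2)) / (norm (P - v1) * norm (Q - v2)))\<bar>))"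

definition Delta' :: "nat \<Rightarrow> complex \<Rightarrow> complex \<Rightarrow> real" where
  "Delta' n P Q = ln ((exp (real n * hdist P Q) + 1) / (exp (real n * hdist P Q) - 1))"

definition hdelta :: "complex \<Rightarrow> complex \<Rightarrow> complex \<Rightarrow> real" where
  "hdelta P Q R = Inf {hdist R S | S. S \<in> ball 0 1 \<and> cross P Q S = 0}"

end

theory Submission
  imports Defs
begin

text \<open>With half-angles, the chord from cis (2 \<alpha>) to cis (2 \<beta>) passes through z iff cis \<alpha> and
  cis \<beta> are orthogonal for a positive definite form depending affinely on z. Hence \<psi> for the
  triangle lifts to the minimum F of the three involutions attached to P, Q and R, an increasing
  map commuting with the translation by \<pi>. In the basis given by the ends of the chord PQ, the
  three forms are determined by u = exp (- d'(P, Q)), by \<tau> = tanh (\<delta>(P, Q, R)) and by the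
  position of P on its line; the two bounds on \<delta> compare \<tau> with u and with
  2 u^2 / (1 + u^4), the double-angle value of tanh for u^2. Each of the four possible
  inequalities bounds the fifth iterate of F at a suitable point above or below by two turns. By
  the intermediate value theorem F has a point of period five winding twice, so the rotation
  number is 2/5.\<close>

section \<open>Rotation numbers from periodic points\<close>

text \<open>As F is a minimum, an upper bound for an iterate needs one form per step, but a lower
  bound needs all three at every step; this dictates the test points. At \<alpha>, an end of the
  chord PQ, the involutions of P and Q agree, and the orbit of \<alpha> closes up after five steps
  and two turns when \<tau> = u. The other threshold belongs to the word R, P, Q, P, Q: it fixes the
  boundary point with coordinate - y iff u^4 y^2 - \<tau> (1 + u^4) y + 1 = 0, which has a real
  solution iff \<tau> (1 + u^4) \<ge> 2 u^2; at equality the double root is y = 1 / u^2, the test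
  point for the upper bound. Below this threshold the lower bound starts at an end of the chord PR,
  where the involutions of P and R agree. Each case of the hypothesis pairs an upper bound from one
  threshold with a lower bound from the other.\<close>

lemma rotation_number_of_periodic_point:
  fixes F :: "real \<Rightarrow> real" and k m :: nat
  assumes mono: "mono F" and per: "\<And>x. F (x + 1) = F x + 1"
    and iter: "(F ^^ k) x0 = x0 + real m" and k: "k > 0"
  shows "(\<lambda>n. ((F ^^ n) x - x) / real n) \<longlonglongrightarrow> real m / real k"
proof -
  have perm: "F (y - 1) = F y - 1" for y using per[of "y - 1"] by simp
  have Fj: "F (y + of_int j) = F y + of_int j" for y j
  proof (induction j rule: int_induct[where k = 0])
    case base then show ?case by simp
  next
    case (step1 i) then show ?case using per[of "y + of_int i"] by (simp add: add.assoc)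
  next
    case (step2 i) then show ?case using perm[of "y + of_int i"] by (simp add: algebra_simps)
  qed
  have Fnj: "(F ^^ n) (y + of_int j) = (F ^^ n) y + of_int j" for n y j
    by (induction n) (simp_all add: Fj)
  have Fnmono: "mono (F ^^ n)" for n
    by (induction n) (use mono in \<open>auto simp: mono_def\<close>)
  \<comment> \<open>The deviation of the orbit of \<open>x0\<close> from linear growth is periodic
    in \<open>n\<close>, hence bounded. Any \<open>x\<close> lies between two consecutive integer
    translates of \<open>x0\<close>, and monotonicity keeps its orbit between theirs.\<close>
  define d where "d n = (F ^^ n) x0 - real n * (real m / real k)" for n
  have dk: "d (n + k) = d n" for n
  proof -
    have "(F ^^ (n + k)) x0 = (F ^^ n) (x0 + of_int (int m))"
      by (simp add: funpow_add iter)
    then have "(F ^^ (n + k)) x0 = (F ^^ n) x0 + real m"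
      using Fnj[of n x0 "int m"] by simp
    then show ?thesis using k by (simp add: d_def field_simps)
  qed
  have dmul: "d (n + j * k) = d n" for n j
  proof (induction j)
    case (Suc j)
    then show ?case using dk[of "n + j * k"] by (simp add: ac_simps)
  qed simp
  have dmod: "d n = d (n mod k)" for n
    using dmul[of "n mod k" "n div k"] by (simp add: mult.commute)
  obtain M where M: "\<And>n. \<bar>d n\<bar> \<le> M"
  proof -
    have "\<bar>d n\<bar> \<le> Max ((\<lambda>i. \<bar>d i\<bar>) ` {..<k})" for n
      using k by (subst dmod) (auto intro!: Max_ge)
    then show ?thesis using that by blast
  qed
  define j where "j = \<lfloor>x - x0\<rfloor>"
  have j: "x0 + of_int j \<le> x" "x \<le> x0 + of_int (j + 1)"
    unfolding j_def by linarith+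
  define C where "C = M + \<bar>of_int j\<bar> + 1 + \<bar>x\<bar>"
  have bound: "\<bar>(F ^^ n) x - x - real n * (real m / real k)\<bar> \<le> C" for n
  proof -
    have "(F ^^ n) x0 + of_int j \<le> (F ^^ n) x" "(F ^^ n) x \<le> (F ^^ n) x0 + of_int (j + 1)"
      using monoD[OF Fnmono j(1)] monoD[OF Fnmono j(2)] by (simp_all only: Fnj)
    then show ?thesis using M[of n] unfolding C_def d_def by (simp add: abs_le_iff) linarith
  qed
  have "(\<lambda>n. C / real n) \<longlonglongrightarrow> 0" by (rule lim_const_over_n)
  then have "(\<lambda>n. ((F ^^ n) x - x) / real n - real m / real k) \<longlonglongrightarrow> 0"
  proof (rule Lim_null_comparison[rotated])
    show "\<forall>\<^sub>F n in sequentially. norm (((F ^^ n) x - x) / real n - real m / real k) \<le> C / real n"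
      using eventually_gt_at_top[of 0]
    proof eventually_elim
      case (elim n)
      then have "((F ^^ n) x - x) / real n - real m / real k
          = ((F ^^ n) x - x - real n * (real m / real k)) / real n"
        by (simp add: diff_divide_distrib)
      then show ?case using bound[of n] elim by (simp add: abs_divide divide_right_mono)
    qed
  qed
  then show ?thesis by (simp add: LIM_zero_iff)
qed

section \<open>The tangent map of a triangle\<close>

text \<open>For unit \<open>v\<close> and \<open>w\<close> this is \<open>cross\<close> at their
  squares divided by twice the sine of the angle from \<open>v\<close> to \<open>w\<close>. The
  division removes the trivial zero at v = w and leaves a symmetric real bilinear form.\<close>

definition chord_form :: "complex \<Rightarrow> complex \<Rightarrow> complex \<Rightarrow> real" where
  "chord_form z v w = Re (cnj v * w) - Re (z * cnj v * cnj w)"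

text \<open>The form at \<theta>, \<phi> is the real part of
  \<open>cis (\<theta> - \<phi>) * (1 - z * cis (- 2 * \<theta>))\<close>; the lift is its only zero
  \<phi> strictly between \<theta> and \<theta> + pi. The second factor has positive real part, so
  the principal argument is already continuous.\<close>

definition chord_lift :: "complex \<Rightarrow> real \<Rightarrow> real" where
  "chord_lift z \<theta> = \<theta> + pi / 2 + Arg (1 - z * cis (- 2 * \<theta>))"

lemma chord_form_commute: "chord_form z v w = chord_form z w v"
  by (simp add: chord_form_def algebra_simps)

lemma chord_form_cis:
  "chord_form z (cis \<alpha>) (cis \<beta>) = cos (\<beta> - \<alpha>) - Re (z * cis (- (\<alpha> + \<beta>)))"
  by (simp add: chord_form_def cis_cnj cis_mult mult.assoc)

text \<open>Rotating back by the mean angle makes the chord vertical, so that the cross product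
  becomes a difference of real parts.\<close>

lemma cross_cis:
  "cross (cis (2 * \<alpha>)) (cis (2 * \<beta>)) z = 2 * sin (\<beta> - \<alpha>) * chord_form z (cis \<alpha>) (cis \<beta>)"
proof -
  define m e where "m = cis (\<alpha> + \<beta>)" and "e = cis (\<beta> - \<alpha>)"
  have v: "cis (2 * \<alpha>) = m * cnj e" and w: "cis (2 * \<beta>) = m * e"
    by (simp_all add: m_def e_def cis_mult cis_cnj)
  have mm: "cnj m * m = 1" by (simp add: m_def cis_cnj cis_mult)
  have ee: "cnj e - e = - 2 * \<i> * sin (\<beta> - \<alpha>)" by (simp add: e_def complex_eq_iff)
  have "cnj (m * e - m * cnj e) * (z - m * cnj e)
      = (cnj e - e) * (cnj m * z - (cnj m * m) * cnj e)"
    by (simp add: algebra_simps)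
  also have "\<dots> = - 2 * \<i> * sin (\<beta> - \<alpha>) * (cnj m * z - cnj e)" by (simp add: mm ee)
  finally have "cross (m * cnj e) (m * e) z = 2 * sin (\<beta> - \<alpha>) * (Re e - Re (cnj m * z))"
    by (simp add: cross_def) (simp add: algebra_simps)?
  also have "Re e - Re (cnj m * z) = chord_form z (cis \<alpha>) (cis \<beta>)"
    by (simp add: chord_form_cis m_def e_def cis_cnj mult.commute)
  finally show ?thesis by (simp add: v w)
qed

lemma Re_one_minus_pos:
  assumes "norm z < 1" shows "Re (1 - z * cis t) > 0"
  using complex_Re_le_cmod[of "z * cis t"] assms by (simp add: norm_mult)

lemma chord_lift_bounds:
  assumes "norm z < 1" shows "\<theta> < chord_lift z \<theta>" "chord_lift z \<theta> < \<theta> + pi"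
proof -
  have "\<bar>Arg (1 - z * cis (- 2 * \<theta>))\<bar> < pi / 2"
    using Re_one_minus_pos[OF assms, of "- 2 * \<theta>"] by (subst Arg_Re_pos) simp
  then show "\<theta> < chord_lift z \<theta>" "chord_lift z \<theta> < \<theta> + pi" by (auto simp: chord_lift_def)
qed

lemma chord_form_eq_sin:
  assumes "norm z < 1"
  obtains \<rho> where "\<rho> > 0"
    "\<And>\<phi>. chord_form z (cis \<theta>) (cis \<phi>) = \<rho> * sin (chord_lift z \<theta> - \<phi>)"
proof
  define k where "k = 1 - z * cis (- 2 * \<theta>)"
  have "Re k > 0" unfolding k_def by (rule Re_one_minus_pos[OF assms])
  then show "norm k > 0" by auto
  fix \<phi>
  have 1: "cis (\<theta> - \<phi>) * k = cis (\<theta> - \<phi>) - z * cis (- (\<theta> + \<phi>))"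
    by (simp add: k_def algebra_simps cis_mult)
  have "k = rcis (norm k) (Arg k)" by (simp add: rcis_cmod_Arg)
  then have "cis (\<theta> - \<phi>) * k = rcis (norm k) (\<theta> - \<phi> + Arg k)"
    by (metis cis_rcis_eq mult_1 rcis_mult)
  then have "Re (cis (\<theta> - \<phi>) - z * cis (- (\<theta> + \<phi>))) = norm k * cos (\<theta> - \<phi> + Arg k)"
    unfolding 1 by simp
  moreover have "sin (chord_lift z \<theta> - \<phi>) = cos (\<theta> - \<phi> + Arg k)"
    using sin_add[of "\<theta> - \<phi> + Arg k" "pi / 2"]
    by (simp add: chord_lift_def k_def algebra_simps)
  moreover have "cos (\<phi> - \<theta>) = cos (\<theta> - \<phi>)" by (metis cos_minus minus_diff_eq)
  ultimately show "chord_form z (cis \<theta>) (cis \<phi>) = norm k * sin (chord_lift z \<theta> - \<phi>)"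
    by (simp add: chord_form_cis)
qed

lemma chord_form_nonneg_iff:
  assumes "norm z < 1" "\<theta> < \<phi>" "\<phi> < \<theta> + pi"
  shows "0 \<le> chord_form z (cis \<theta>) (cis \<phi>) \<longleftrightarrow> \<phi> \<le> chord_lift z \<theta>"
    "chord_form z (cis \<theta>) (cis \<phi>) \<le> 0 \<longleftrightarrow> chord_lift z \<theta> \<le> \<phi>"
proof -
  obtain \<rho> where \<rho>: "\<rho> > 0"
    "chord_form z (cis \<theta>) (cis \<phi>) = \<rho> * sin (chord_lift z \<theta> - \<phi>)"
    using chord_form_eq_sin[OF assms(1)] by metis
  define t where "t = chord_lift z \<theta> - \<phi>"
  have t: "- pi < t" "t < pi"
    using chord_lift_bounds[OF assms(1), of \<theta>] assms by (auto simp: t_def)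
  have "0 < sin t" if "0 < t" using sin_gt_zero[of t] that t by simp
  moreover have "sin t < 0" if "t < 0" using sin_gt_zero[of "- t"] that t by simp
  ultimately have "0 \<le> sin t \<longleftrightarrow> 0 \<le> t" "sin t \<le> 0 \<longleftrightarrow> t \<le> 0"
    by (cases t "0::real" rule: linorder_cases; auto)+
  then show "0 \<le> chord_form z (cis \<theta>) (cis \<phi>) \<longleftrightarrow> \<phi> \<le> chord_lift z \<theta>"
    "chord_form z (cis \<theta>) (cis \<phi>) \<le> 0 \<longleftrightarrow> chord_lift z \<theta> \<le> \<phi>"
    using \<rho> by (auto simp: t_def zero_le_mult_iff mult_le_0_iff)
qed

lemma chord_form_minus_right: "chord_form z v (- w) = - chord_form z v w"
  by (simp add: chord_form_def)

lemma cis_add_pi: "cis (x + pi) = - cis x"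
  by (simp add: complex_eq_iff)

text \<open>Orthogonality is symmetric, and negating a vector adds pi to its angle. In half-angles
  pi is one full turn, so this is an involution of the circle.\<close>

lemma chord_lift_involution:
  assumes "norm z < 1"
  shows "chord_lift z (chord_lift z \<theta>) = \<theta> + pi"
proof -
  define v where "v = chord_lift z \<theta>"
  have v: "\<theta> < v" "v < \<theta> + pi" using chord_lift_bounds[OF assms] by (auto simp: v_def)
  have "chord_form z (cis \<theta>) (cis v) = 0"
    using chord_form_nonneg_iff[OF assms v] by (simp add: v_def)
  then have "chord_form z (cis v) (cis (\<theta> + pi)) = 0"
    by (simp add: cis_add_pi chord_form_minus_right chord_form_commute)
  then show ?thesis
    using chord_form_nonneg_iff[OF assms, of v "\<theta> + pi"] v by (simp add: v_def)
qed

text \<open>The sine formula based at the image \<open>v\<close> of \<theta>, whose own image is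
  \<theta> + pi, gives the sign of the form at \<theta>' and \<open>v\<close>, and thereby places
  \<open>v\<close> before the image of \<theta>'.\<close>

lemma chord_lift_mono:
  assumes "norm z < 1"
  shows "mono (chord_lift z)"
proof (rule monoI)
  fix \<theta> \<theta>' :: real assume le: "\<theta> \<le> \<theta>'"
  define v where "v = chord_lift z \<theta>"
  have v: "\<theta> < v" "v < \<theta> + pi" using chord_lift_bounds[OF assms] by (auto simp: v_def)
  show "chord_lift z \<theta> \<le> chord_lift z \<theta>'"
  proof (cases "v \<le> \<theta>'")
    case True
    then show ?thesis using chord_lift_bounds(1)[OF assms, of \<theta>'] by (simp add: v_def)
  next
    case False
    obtain \<rho> where \<rho>: "\<rho> > 0"
      "chord_form z (cis v) (cis \<theta>') = \<rho> * sin (\<theta> + pi - \<theta>')"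
      using chord_form_eq_sin[OF assms, of v] chord_lift_involution[OF assms, of \<theta>]
      by (metis v_def)
    have "0 \<le> sin (\<theta> + pi - \<theta>')" using False v le by (intro sin_ge_zero) auto
    then have "0 \<le> chord_form z (cis \<theta>') (cis v)" using \<rho> by (simp add: chord_form_commute)
    then show ?thesis
      using chord_form_nonneg_iff(1)[OF assms, of \<theta>' v] False v le by (simp add: v_def)
  qed
qed

lemma chord_lift_add_pi: "chord_lift z (\<theta> + pi) = chord_lift z \<theta> + pi"
proof -
  have "cis (- 2 * (\<theta> + pi)) = cis (- 2 * \<theta>)"
    by (simp add: complex_eq_iff distrib_left cos_diff sin_diff)
  then show ?thesis by (simp add: chord_lift_def)
qed

lemma continuous_chord_lift:
  assumes "norm z < 1" shows "continuous_on S (chord_lift z)"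
proof -
  have "1 - z * cis (- 2 * \<theta>) \<notin> \<real>\<^sub>\<le>\<^sub>0" for \<theta>
    using Re_one_minus_pos[OF assms, of "- 2 * \<theta>"]
    by (auto simp: complex_nonpos_Reals_iff)
  then show ?thesis unfolding chord_lift_def
    by (intro continuous_intros) auto
qed

text \<open>Reduces sign conditions on the filled triangle to its three vertices.\<close>

lemma chord_form_affine:
  assumes "a + b + c = 1"
  shows "chord_form (a *\<^sub>R P + b *\<^sub>R Q + c *\<^sub>R R) v w
    = a * chord_form P v w + b * chord_form Q v w + c * chord_form R v w"
proof -
  have c: "c = 1 - a - b" using assms by simp
  show ?thesis
    unfolding c by (simp add: chord_form_def scaleR_conv_of_real algebra_simps)
qed

section \<open>The lift of the tangent map as a minimum over the vertices\<close>

definition triangle_lift :: "complex \<Rightarrow> complex \<Rightarrow> complex \<Rightarrow> real \<Rightarrow> real" where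
  "triangle_lift P Q R \<theta> = min (chord_lift P \<theta>) (min (chord_lift Q \<theta>) (chord_lift R \<theta>))"

lemma cis_eq_iff_diff: "cis x = cis y \<longleftrightarrow> (\<exists>n::int. x = y + 2 * pi * of_int n)"
proof -
  have "cis x = cis y \<longleftrightarrow> sin x = sin y \<and> cos x = cos y" by (auto simp: complex_eq_iff)
  then show ?thesis by (simp add: sin_cos_eq_iff algebra_simps)
qed

lemma unit_point_half_angle:
  assumes "norm w = 1" "w \<noteq> cis (2 * \<theta>)"
  obtains \<phi> where "w = cis (2 * \<phi>)" "\<theta> < \<phi>" "\<phi> < \<theta> + pi"
proof -
  define t where "t = Arg w"
  have w: "w = cis t"
    using assms rcis_cmod_Arg[of w] by (simp add: t_def rcis_def)
  define n where "n = \<lfloor>(t / 2 - \<theta>) / pi\<rfloor>"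
  define \<phi> where "\<phi> = t / 2 - of_int n * pi"
  have "of_int n \<le> (t / 2 - \<theta>) / pi" "(t / 2 - \<theta>) / pi < of_int n + 1"
    unfolding n_def by linarith+
  then have le: "\<theta> \<le> \<phi>" and lt: "\<phi> < \<theta> + pi"
    by (simp_all add: \<phi>_def field_simps)
  have eq: "w = cis (2 * \<phi>)"
    unfolding w cis_eq_iff_diff by (rule exI[of _ n]) (simp add: \<phi>_def algebra_simps)
  then have "\<theta> \<noteq> \<phi>" using assms by auto
  then show thesis using that[OF eq] le lt by simp
qed

lemma triangle_lift_properties:
  assumes "norm P < 1" "norm Q < 1" "norm R < 1"
  shows "\<theta> < triangle_lift P Q R \<theta>" "triangle_lift P Q R \<theta> < \<theta> + pi"
    "mono (triangle_lift P Q R)" "continuous_on S (triangle_lift P Q R)"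
    "triangle_lift P Q R (\<theta> + pi) = triangle_lift P Q R \<theta> + pi"
proof -
  show "\<theta> < triangle_lift P Q R \<theta>" "triangle_lift P Q R \<theta> < \<theta> + pi"
    using assms[THEN chord_lift_bounds(1), of \<theta>] assms[THEN chord_lift_bounds(2), of \<theta>]
    by (auto simp: triangle_lift_def)
  show "mono (triangle_lift P Q R)"
    unfolding triangle_lift_def
    using assms[THEN chord_lift_mono] by (intro monoI min.mono) (auto dest: monoD)
  show "continuous_on S (triangle_lift P Q R)"
    unfolding triangle_lift_def using assms by (intro continuous_intros continuous_chord_lift)
  show "triangle_lift P Q R (\<theta> + pi) = triangle_lift P Q R \<theta> + pi"
    by (simp add: triangle_lift_def chord_lift_add_pi min_add_distrib_left)
qed

text \<open>A chord ending at half-angle \<phi> has the triangle on its left iff \<phi> is at most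
  all three vertex lifts, and it misses the triangle if \<phi> is smaller than all of them. Only the
  minimum remains as a value for the definite description.\<close>

lemma psi_triangle:
  assumes "norm P < 1" "norm Q < 1" "norm R < 1"
  shows "psi (convex hull {P, Q, R}) (cis (2 * \<theta>)) = cis (2 * triangle_lift P Q R \<theta>)"
proof -
  let ?U = "convex hull {P, Q, R}"
  define \<beta> where "\<beta> = triangle_lift P Q R \<theta>"
  have \<beta>: "\<theta> < \<beta>" "\<beta> < \<theta> + pi"
    using triangle_lift_properties(1,2)[OF assms] by (auto simp: \<beta>_def)
  have vert: "P \<in> ?U" "Q \<in> ?U" "R \<in> ?U" by (auto intro: hull_inc)
  have pos_if: "0 < chord_form z (cis \<theta>) (cis \<phi>)"
    if "z \<in> ?U" "\<theta> < \<phi>" "\<phi> < \<beta>" for z \<phi>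
  proof -
    have \<phi>: "\<theta> < \<phi>" "\<phi> < \<theta> + pi" using that \<beta> by auto
    have pos: "0 < chord_form P (cis \<theta>) (cis \<phi>)" "0 < chord_form Q (cis \<theta>) (cis \<phi>)"
      "0 < chord_form R (cis \<theta>) (cis \<phi>)"
      using assms[THEN chord_form_nonneg_iff(2), OF \<phi>] that
      by (auto simp: \<beta>_def triangle_lift_def simp flip: not_le)
    obtain a b c where abc: "0 \<le> a" "0 \<le> b" "0 \<le> c" "a + b + c = 1"
      "z = a *\<^sub>R P + b *\<^sub>R Q + c *\<^sub>R R"
      using \<open>z \<in> ?U\<close> unfolding convex_hull_3 by blast
    have "a > 0 \<or> b > 0 \<or> c > 0" using abc by linarith
    then show ?thesis unfolding abc(5) chord_form_affine[OF abc(4)]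
      using pos abc(1-3)
      by (smt (verit) mult_nonneg_nonneg mult_pos_pos)
  qed
  have nonneg: "0 \<le> chord_form z (cis \<theta>) (cis \<beta>)" if "z \<in> ?U" for z
  proof -
    have pos: "0 \<le> chord_form P (cis \<theta>) (cis \<beta>)" "0 \<le> chord_form Q (cis \<theta>) (cis \<beta>)"
      "0 \<le> chord_form R (cis \<theta>) (cis \<beta>)"
      using assms[THEN chord_form_nonneg_iff(1), OF \<beta>]
      by (auto simp: \<beta>_def triangle_lift_def)
    obtain a b c where abc: "0 \<le> a" "0 \<le> b" "0 \<le> c" "a + b + c = 1"
      "z = a *\<^sub>R P + b *\<^sub>R Q + c *\<^sub>R R"
      using \<open>z \<in> ?U\<close> unfolding convex_hull_3 by blast
    show ?thesis unfolding abc(5) chord_form_affine[OF abc(4)] using pos abc(1-3) by simp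
  qed
  have "\<exists>z\<in>{P, Q, R}. \<beta> = chord_lift z \<theta>"
    by (auto simp: \<beta>_def triangle_lift_def min_def)
  then obtain z0 where z0: "z0 \<in> {P, Q, R}" "\<beta> = chord_lift z0 \<theta>" by blast
  have z0': "norm z0 < 1" using z0 assms by auto
  have zero: "chord_form z0 (cis \<theta>) (cis \<beta>) = 0"
    using chord_form_nonneg_iff[OF z0' \<beta>] z0(2) by simp
  have sin_pos: "0 < sin (\<phi> - \<theta>)" if "\<theta> < \<phi>" "\<phi> < \<theta> + pi" for \<phi>
    using that by (intro sin_gt_zero) auto
  show ?thesis unfolding psi_def \<beta>_def[symmetric]
  proof (rule the_equality, intro conjI)
    show "norm (cis (2 * \<beta>)) = 1" by simp
    show "cis (2 * \<beta>) \<noteq> cis (2 * \<theta>)"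
    proof
      assume "cis (2 * \<beta>) = cis (2 * \<theta>)"
      then obtain n :: int where "2 * \<beta> = 2 * \<theta> + 2 * pi * of_int n"
        unfolding cis_eq_iff_diff ..
      then have "0 < pi * real_of_int n" "pi * real_of_int n < pi * 1" using \<beta> by linarith+
      then have "0 < n" "n < 1" by (simp_all only: zero_less_mult_iff mult_less_cancel_left_pos[OF pi_gt_zero]) auto
      then show False by simp
    qed
    show "\<exists>z\<in>?U. cross (cis (2 * \<theta>)) (cis (2 * \<beta>)) z = 0"
      using z0(1) vert zero by (intro bexI[of _ z0]) (auto simp: cross_cis)
    show "\<forall>z\<in>?U. 0 \<le> cross (cis (2 * \<theta>)) (cis (2 * \<beta>)) z"
      using nonneg sin_pos[OF \<beta>] by (simp add: cross_cis)
  next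
    fix w
    assume w: "norm w = 1 \<and> w \<noteq> cis (2 * \<theta>) \<and>
      (\<exists>z\<in>?U. cross (cis (2 * \<theta>)) w z = 0) \<and> (\<forall>z\<in>?U. 0 \<le> cross (cis (2 * \<theta>)) w z)"
    then obtain \<phi> where \<phi>: "w = cis (2 * \<phi>)" "\<theta> < \<phi>" "\<phi> < \<theta> + pi"
      using unit_point_half_angle by metis
    have s: "0 < sin (\<phi> - \<theta>)" using sin_pos \<phi> by blast
    have "0 \<le> chord_form z0 (cis \<theta>) (cis \<phi>)"
      using w z0(1) vert s unfolding \<phi>(1) cross_cis by (auto simp: zero_le_mult_iff)
    then have "\<phi> \<le> \<beta>" using chord_form_nonneg_iff(1)[OF z0' \<phi>(2,3)] z0(2) by simp
    moreover have "\<not> \<phi> < \<beta>"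
    proof
      assume "\<phi> < \<beta>"
      then show False using pos_if[OF _ \<phi>(2)] w s unfolding \<phi>(1) cross_cis by fastforce
    qed
    ultimately show "w = cis (2 * \<beta>)" using \<phi>(1) by simp
  qed
qed

text \<open>Two lifts differ by a continuous integer-valued function, hence by a constant; the
  normalization at 0 makes it zero.\<close>

lemma circle_lift_eqI:
  assumes cont: "continuous_on UNIV F" and F0: "F 0 \<in> {0..<1}"
    and lift: "\<And>x. f (cis (2 * pi * x)) = cis (2 * pi * F x)"
  shows "circle_lift f = F"
  unfolding circle_lift_def
proof (rule the_equality)
  show "continuous_on UNIV F \<and> F 0 \<in> {0..<1} \<and> (\<forall>x. f (cis (2 * pi * x)) = cis (2 * pi * F x))"
    using assms by blast
next
  fix G assume G: "continuous_on UNIV G \<and> G 0 \<in> {0..<1} \<and>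
    (\<forall>x. f (cis (2 * pi * x)) = cis (2 * pi * G x))"
  have int: "G x - F x \<in> \<int>" for x
  proof -
    have "cis (2 * pi * G x) = cis (2 * pi * F x)" using G lift by simp
    then obtain n :: int where "2 * pi * G x = 2 * pi * (F x + of_int n)"
      by (auto simp: cis_eq_iff_diff algebra_simps)
    then have "G x - F x = of_int n" by simp
    then show ?thesis by simp
  qed
  have "(\<lambda>x. G x - F x) constant_on UNIV"
  proof (rule continuous_discrete_range_constant)
    show "connected (UNIV :: real set)" by simp
    show "continuous_on UNIV (\<lambda>x. G x - F x)" using G cont by (intro continuous_intros) auto
    fix x :: real
    show "\<exists>e>0. \<forall>y. y \<in> UNIV \<and> G y - F y \<noteq> G x - F x \<longrightarrow> e \<le> norm (G y - F y - (G x - F x))"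
    proof (intro exI[of _ 1] conjI allI impI)
      fix y assume "y \<in> UNIV \<and> G y - F y \<noteq> G x - F x"
      moreover have "G y - F y - (G x - F x) \<in> \<int>" by (rule Ints_diff[OF int int])
      ultimately show "1 \<le> norm (G y - F y - (G x - F x))"
        using Ints_nonzero_abs_ge1 by fastforce
    qed simp
  qed
  then obtain c where c: "\<And>x. G x - F x = c" by (auto simp: constant_on_def)
  have "c \<in> \<int>" using int c by metis
  moreover have "\<bar>c\<bar> < 1" using c[of 0] G F0 by auto
  ultimately have "c = 0" using Ints_nonzero_abs_ge1 by fastforce
  then show "G = F" using c by (auto simp: fun_eq_iff)
qed

text \<open>Division by pi turns half-angles into the normalized angle, so 2 * pi counts as two
  turns.\<close>

lemma rotation_number_triangle:
  assumes ball: "norm P < 1" "norm Q < 1" "norm R < 1"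
    and le: "(triangle_lift P Q R ^^ 5) \<theta>1 \<le> \<theta>1 + 2 * pi"
    and ge: "\<theta>2 + 2 * pi \<le> (triangle_lift P Q R ^^ 5) \<theta>2"
  shows "(\<lambda>n. ((circle_lift (psi (convex hull {P, Q, R})) ^^ n) x - x) / real n)
              \<longlonglongrightarrow> 2 / 5"
proof -
  define F where "F = triangle_lift P Q R"
  note props = triangle_lift_properties[OF ball, folded F_def]
  define G where "G x = F (pi * x) / pi" for x
  have Gn: "(G ^^ n) x = (F ^^ n) (pi * x) / pi" for n x
    by (induction n) (simp_all add: G_def)
  have lift: "circle_lift (psi (convex hull {P, Q, R})) = G"
  proof (rule circle_lift_eqI)
    show "continuous_on UNIV G" unfolding G_def
      by (intro continuous_intros continuous_on_compose2[OF props(4)[of UNIV]]) auto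
    show "G 0 \<in> {0..<1}" using props(1,2)[of 0] by (simp add: G_def)
    show "psi (convex hull {P, Q, R}) (cis (2 * pi * x)) = cis (2 * pi * G x)" for x
      using psi_triangle[OF ball, of "pi * x"] by (simp add: G_def F_def mult.assoc)
  qed
  have "mono G" using monoD[OF props(3)] by (auto simp: G_def mono_def divide_right_mono)
  moreover have "G (y + 1) = G y + 1" for y
    using props(5)[of "pi * y"] by (simp add: G_def algebra_simps add_divide_distrib)
  moreover obtain x0 where "(G ^^ 5) x0 = x0 + real 2"
  proof -
    have cont: "continuous_on UNIV (F ^^ n)" for n
    proof (induction n)
      case (Suc n)
      then show ?case
        using continuous_on_compose[OF Suc continuous_on_subset[OF props(4)[of UNIV]]] by simp
    qed (simp add: id_def)
    have "connected ((\<lambda>\<theta>. (F ^^ 5) \<theta> - \<theta>) ` UNIV)"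
      by (intro connected_continuous_image continuous_intros cont) auto
    moreover have "(F ^^ 5) \<theta>1 - \<theta>1 \<le> 2 * pi" "2 * pi \<le> (F ^^ 5) \<theta>2 - \<theta>2"
      using le ge by (simp_all add: F_def)
    ultimately have "2 * pi \<in> (\<lambda>\<theta>. (F ^^ 5) \<theta> - \<theta>) ` UNIV"
      using connectedD_interval[of _ "(F ^^ 5) \<theta>1 - \<theta>1" "(F ^^ 5) \<theta>2 - \<theta>2" "2 * pi"] by blast
    then obtain \<theta> where "(F ^^ 5) \<theta> = \<theta> + 2 * pi" by (auto simp: algebra_simps)
    then have "(G ^^ 5) (\<theta> / pi) = \<theta> / pi + real 2" by (simp add: Gn field_simps)
    then show ?thesis using that by blast
  qed
  ultimately have "(\<lambda>n. ((G ^^ n) x - x) / real n) \<longlonglongrightarrow> real 2 / real 5"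
    by (intro rotation_number_of_periodic_point) auto
  then show ?thesis by (simp add: lift)
qed

section \<open>Orbits in coordinates adapted to the chord PQ\<close>

lemma angle_of_positive_combination:
  assumes "\<theta> < \<phi>" "\<phi> < \<theta> + pi" "0 < X" "0 < Y"
  obtains \<omega> r where "\<theta> < \<omega>" "\<omega> < \<phi>" "0 < r"
    "of_real X * cis \<theta> + of_real Y * cis \<phi> = of_real r * cis \<omega>"
proof -
  define w where "w = of_real X * cis \<theta> + of_real Y * cis \<phi>"
  have Im1: "Im (cis (- \<theta>) * w) = Y * sin (\<phi> - \<theta>)"
    by (simp add: w_def algebra_simps sin_diff)
  have Im2: "Im (cis (- \<phi>) * w) = - (X * sin (\<phi> - \<theta>))"
    by (simp add: w_def algebra_simps sin_diff)
  have s: "0 < sin (\<phi> - \<theta>)" using assms by (intro sin_gt_zero) auto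
  then have Im1_pos: "0 < Im (cis (- \<theta>) * w)" using Im1 assms by simp
  then have w0: "w \<noteq> 0" by auto
  define r where "r = norm w"
  have r: "0 < r" using w0 by (simp add: r_def)
  have "w / r \<noteq> cis (2 * (\<theta> / 2))"
  proof
    assume "w / r = cis (2 * (\<theta> / 2))"
    then have "w = r * cis \<theta>" using r by (simp add: field_simps)
    then have "cis (- \<theta>) * w = r" by (simp add: cis_mult mult.left_commute)
    then show False using Im1_pos by simp
  qed
  moreover have "norm (w / r) = 1" using w0 by (simp add: r_def norm_divide)
  \<comment> \<open>Used at \<theta> / 2, this gives an angle \<omega> only up to \<theta> + 2 * pi;
    the signs of the two sines below then cut it down to the arc from \<theta> to \<phi>.\<close>
  ultimately obtain \<phi>' where \<phi>': "w / r = cis (2 * \<phi>')" "\<theta> / 2 < \<phi>'" "\<phi>' < \<theta> / 2 + pi"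
    using unit_point_half_angle by metis
  define \<omega> where "\<omega> = 2 * \<phi>'"
  have w: "w = r * cis \<omega>" using \<phi>'(1) r by (simp add: \<omega>_def field_simps)
  have \<omega>: "\<theta> < \<omega>" "\<omega> < \<theta> + 2 * pi" using \<phi>' by (auto simp: \<omega>_def)
  have shift: "Im (cis (- t) * w) = r * sin (\<omega> - t)" for t
    by (simp add: w cis_mult mult.left_commute)
  have "0 < sin (\<omega> - \<theta>)" using Im1_pos r unfolding shift by (simp add: zero_less_mult_iff)
  then have "\<omega> < \<theta> + pi" using sin_ge_zero[of "\<omega> - \<theta> - pi"] \<omega>
    by (cases "\<omega> < \<theta> + pi") (auto simp: sin_diff)
  have "r * sin (\<omega> - \<phi>) < 0" using Im2 mult_pos_pos[OF assms(3) s] unfolding shift by linarith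
  then have "sin (\<omega> - \<phi>) < 0" using r by (simp add: mult_less_0_iff)
  then have "\<omega> < \<phi>" using sin_ge_zero[of "\<omega> - \<phi>"] \<omega> \<open>\<omega> < \<theta> + pi\<close> assms by linarith
  then show thesis using that \<omega> r w by (simp add: w_def)
qed

lemma chord_form_scale:
  "chord_form z (of_real r * v) (of_real s * w) = r * s * chord_form z v w"
  by (simp add: chord_form_def algebra_simps)

text \<open>\<open>k\<close> rescales the second basis vector so that the form of R has equal
  diagonal entries; the forms of P and Q are diagonal because both points lie on the chord of the
  basis. The order of P and Q along the chord gives Q the factor 1 / u^2, and \<tau> > 0 encodes
  that R lies to the left of PQ. The positive factors \<open>cP\<close>, \<open>cQ\<close>,
  \<open>cR\<close> do not affect signs.\<close>

locale normalized_triangle =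
  fixes P Q R :: complex and \<alpha> \<beta> k m u \<tau> cP cQ cR :: real
  assumes ball: "norm P < 1" "norm Q < 1" "norm R < 1"
    and angles: "\<alpha> < \<beta>" "\<beta> < \<alpha> + pi"
    and pos: "0 < k" "0 < cP" "0 < cQ" "0 < cR" "0 < m"
    and u: "0 < u" "u < 1" and \<tau>: "0 < \<tau>" "\<tau> < 1"
  fixes vec :: "real \<Rightarrow> real \<Rightarrow> complex"
  defines "vec \<equiv> \<lambda>\<xi> \<eta>. of_real \<xi> * cis \<alpha> + of_real (k * \<eta>) * cis \<beta>"
  assumes form_P: "chord_form P (vec \<xi> \<eta>) (vec \<xi>' \<eta>') = cP * (m * \<xi> * \<xi>' + \<eta> * \<eta>')"
    and form_Q: "chord_form Q (vec \<xi> \<eta>) (vec \<xi>' \<eta>') = cQ * (m / u\<^sup>2 * \<xi> * \<xi>' + \<eta> * \<eta>')"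
    and form_R: "chord_form R (vec \<xi> \<eta>) (vec \<xi>' \<eta>')
      = cR * (\<xi> * \<xi>' + \<eta> * \<eta>' + \<tau> * (\<xi> * \<eta>' + \<eta> * \<xi>'))"
begin

abbreviation "F \<equiv> triangle_lift P Q R"

definition is_dir :: "real \<Rightarrow> real \<Rightarrow> real \<Rightarrow> bool" where
  "is_dir \<theta> \<xi> \<eta> \<longleftrightarrow> (\<exists>r>0. vec \<xi> \<eta> = of_real r * cis \<theta>)"

text \<open>In the coordinate \<eta> / \<xi> on the projective line, g x and h y are the boundary points x > 0
  and - y < 0; the ends of the chord PQ are 0 (at \<alpha>) and infinity (at \<beta>). The involutions of P, Q
  and R are x \<mapsto> - m / x, x \<mapsto> - m / (u^2 x) and x \<mapsto> - (\<tau> x + 1) / (x + \<tau>).\<close>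

definition g :: "real \<Rightarrow> real" where
  "g x = (SOME \<omega>. \<alpha> < \<omega> \<and> \<omega> < \<beta> \<and> is_dir \<omega> 1 x)"

definition h :: "real \<Rightarrow> real" where
  "h y = (SOME \<omega>. \<beta> < \<omega> \<and> \<omega> < \<alpha> + pi \<and> is_dir \<omega> (- 1) y)"

lemma g:
  assumes "0 < x" shows "\<alpha> < g x" "g x < \<beta>" "is_dir (g x) 1 x"
proof -
  have "\<exists>\<omega>. \<alpha> < \<omega> \<and> \<omega> < \<beta> \<and> is_dir \<omega> 1 x"
    using angle_of_positive_combination[OF angles, of 1 "k * x"] pos assms
    unfolding is_dir_def vec_def by (metis mult_pos_pos zero_less_one)
  from someI_ex[OF this, folded g_def] show "\<alpha> < g x" "g x < \<beta>" "is_dir (g x) 1 x" by auto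
qed

lemma h:
  assumes "0 < y" shows "\<beta> < h y" "h y < \<alpha> + pi" "is_dir (h y) (- 1) y"
proof -
  obtain \<omega> r where "\<beta> < \<omega>" "\<omega> < \<alpha> + pi" "0 < r"
    "of_real (k * y) * cis \<beta> + of_real 1 * cis (\<alpha> + pi) = of_real r * cis \<omega>"
    using angle_of_positive_combination[of \<beta> "\<alpha> + pi" "k * y" 1] angles pos assms by auto
  then have "\<exists>\<omega>. \<beta> < \<omega> \<and> \<omega> < \<alpha> + pi \<and> is_dir \<omega> (- 1) y"
    unfolding is_dir_def vec_def by (auto simp: cis_add_pi)
  from someI_ex[OF this, folded h_def] show "\<beta> < h y" "h y < \<alpha> + pi" "is_dir (h y) (- 1) y" by auto
qed

lemma is_dir_add_pi: "is_dir \<theta> \<xi> \<eta> \<Longrightarrow> is_dir (\<theta> + pi) (- \<xi>) (- \<eta>)"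
  unfolding is_dir_def vec_def cis_add_pi
  by (elim ex_forward) (simp add: algebra_simps)

lemma is_dir_\<alpha>: "is_dir \<alpha> 1 0"
  unfolding is_dir_def vec_def by (intro exI[of _ 1]) simp

lemma is_dir_\<beta>: "is_dir \<beta> 0 1"
  unfolding is_dir_def vec_def using pos by (intro exI[of _ k]) simp

lemma h_antimono:
  assumes "0 < y'" "y' < y" shows "h y < h y'"
proof -
  obtain r where r: "r > 0" "vec (- 1) y = of_real r * cis (h y)"
    using h[of y] assms by (auto simp: is_dir_def)
  obtain r' where r': "r' > 0" "vec (- 1) y' = of_real r' * cis (h y')"
    using h[of y'] assms by (auto simp: is_dir_def)
  have "Im (cnj (vec (- 1) y) * vec (- 1) y') = k * (y - y') * sin (\<beta> - \<alpha>)"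
    by (simp add: vec_def sin_diff algebra_simps)
  moreover have "0 < k * (y - y') * sin (\<beta> - \<alpha>)"
    using pos assms angles by (intro mult_pos_pos sin_gt_zero) auto
  moreover have "Im (cnj (vec (- 1) y) * vec (- 1) y') = r * r' * sin (h y' - h y)"
    by (simp add: r r' sin_diff algebra_simps)
  ultimately have "0 < (r * r') * sin (h y' - h y)" by linarith
  then have "0 < sin (h y' - h y)"
    using zero_less_mult_pos mult_pos_pos[OF r(1) r'(1)] by blast
  moreover have "- pi < h y' - h y" using h[of y'] h[of y] assms angles by auto
  ultimately show ?thesis using sin_ge_zero[of "h y - h y'"]
    by (smt (verit) sin_minus)
qed

lemma F_le:
  assumes "is_dir \<theta> \<xi> \<eta>" "is_dir \<phi> \<xi>' \<eta>'" "\<theta> < \<phi>" "\<phi> < \<theta> + pi"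
    and "m * \<xi> * \<xi>' + \<eta> * \<eta>' \<le> 0 \<or> m / u\<^sup>2 * \<xi> * \<xi>' + \<eta> * \<eta>' \<le> 0 \<or>
      \<xi> * \<xi>' + \<eta> * \<eta>' + \<tau> * (\<xi> * \<eta>' + \<eta> * \<xi>') \<le> 0"
  shows "F \<theta> \<le> \<phi>"
proof -
  obtain r s where r: "r > 0" "vec \<xi> \<eta> = of_real r * cis \<theta>" and s: "s > 0" "vec \<xi>' \<eta>' = of_real s * cis \<phi>"
    using assms by (auto simp: is_dir_def)
  have "chord_form z (vec \<xi> \<eta>) (vec \<xi>' \<eta>') \<le> 0 \<longleftrightarrow> chord_lift z \<theta> \<le> \<phi>" if "norm z < 1" for z
    using chord_form_nonneg_iff(2)[OF that assms(3,4)] r s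
    by (simp add: chord_form_scale mult_le_0_iff zero_le_mult_iff)
  note this[OF ball(1)] this[OF ball(2)] this[OF ball(3)]
  then show ?thesis using assms(5) pos
    by (auto simp: form_P form_Q form_R triangle_lift_def mult_le_0_iff min_le_iff_disj)
qed

lemma F_ge:
  assumes "is_dir \<theta> \<xi> \<eta>" "is_dir \<phi> \<xi>' \<eta>'" "\<theta> < \<phi>" "\<phi> < \<theta> + pi"
    and "0 \<le> m * \<xi> * \<xi>' + \<eta> * \<eta>'" "0 \<le> m / u\<^sup>2 * \<xi> * \<xi>' + \<eta> * \<eta>'"
      "0 \<le> \<xi> * \<xi>' + \<eta> * \<eta>' + \<tau> * (\<xi> * \<eta>' + \<eta> * \<xi>')"
  shows "\<phi> \<le> F \<theta>"
proof -
  obtain r s where r: "r > 0" "vec \<xi> \<eta> = of_real r * cis \<theta>" and s: "s > 0" "vec \<xi>' \<eta>' = of_real s * cis \<phi>"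
    using assms by (auto simp: is_dir_def)
  have "0 \<le> chord_form z (vec \<xi> \<eta>) (vec \<xi>' \<eta>') \<longleftrightarrow> \<phi> \<le> chord_lift z \<theta>" if "norm z < 1" for z
    using chord_form_nonneg_iff(1)[OF that assms(3,4)] r s
    by (simp add: chord_form_scale mult_le_0_iff zero_le_mult_iff)
  note this[OF ball(1)] this[OF ball(2)] this[OF ball(3)]
  then show ?thesis using assms(5-) pos
    by (auto simp: form_P form_Q form_R triangle_lift_def zero_le_mult_iff)
qed

lemma m_le: "m \<le> m / u\<^sup>2"
  using pos u by (simp add: le_divide_eq mult_le_cancel_left1 power_le_one)

section \<open>Single steps of F in coordinates\<close>

lemma F_\<alpha>: "F \<alpha> = \<beta>"
  using F_le[OF is_dir_\<alpha> is_dir_\<beta> angles] F_ge[OF is_dir_\<alpha> is_dir_\<beta> angles] \<tau> by simp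

lemma F_\<beta>: "F \<beta> = h \<tau>"
  using F_le[OF is_dir_\<beta> h(3)[of \<tau>]] F_ge[OF is_dir_\<beta> h(3)[of \<tau>]] h(1,2)[of \<tau>] \<tau> angles by simp

text \<open>From a direction between \<alpha> and \<beta> the involution of Q comes no later than
  that of P, by \<open>m_le\<close>; from a direction between \<beta> and \<alpha> + pi the order is
  reversed. Hence Q governs the bounds for \<open>g\<close> and P those from \<open>h\<close> to
  \<open>g\<close>.\<close>

lemma F_g_le:
  assumes "0 < x" "0 < y" "x * y \<le> m / u\<^sup>2"
  shows "F (g x) \<le> h y"
  using F_le[OF g(3)[of x] h(3)[of y]] g(1,2)[of x] h(1,2)[of y] assms by simp

lemma F_g_ge:
  assumes "0 < x" "0 < y" "m / u\<^sup>2 \<le> x * y" "1 \<le> x * y + \<tau> * (y - x)"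
  shows "h y \<le> F (g x)"
  using F_ge[OF g(3)[of x] h(3)[of y]] g(1,2)[of x] h(1,2)[of y] m_le assms by simp

lemma F_h_le:
  assumes "0 < x" "0 < y" "m \<le> x * y"
  shows "F (h y) \<le> g x + pi"
  using F_le[OF h(3)[of y] is_dir_add_pi[OF g(3)[of x]]] g(1,2)[of x] h(1,2)[of y] assms
  by (simp add: mult.commute)

lemma F_h_ge:
  assumes "0 < x" "0 < y" "x * y \<le> m" "0 \<le> 1 - x * y + \<tau> * (x - y)"
  shows "g x + pi \<le> F (h y)"
  using F_ge[OF h(3)[of y] is_dir_add_pi[OF g(3)[of x]]] g(1,2)[of x] h(1,2)[of y] m_le assms
  by (simp add: mult.commute)

text \<open>The forms of P and Q are positive on two directions of the arc from \<beta> to \<alpha>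
  + pi, so only R can lead from one to the other.\<close>

lemma F_h_h_le:
  assumes "0 < y'" "y' < y" "1 + y * y' \<le> \<tau> * (y + y')"
  shows "F (h y) \<le> h y'"
  using F_le[OF h(3)[of y] h(3)[of y']] h(1,2)[of y] h(1,2)[of y'] h_antimono[of y' y] angles assms
  by (simp add: algebra_simps)

lemma F_h_h_ge:
  assumes "0 < y'" "y' < y" "\<tau> * (y + y') \<le> 1 + y * y'"
  shows "h y' \<le> F (h y)"
  using F_ge[OF h(3)[of y] h(3)[of y']] h(1,2)[of y] h(1,2)[of y'] h_antimono[of y' y] angles pos assms
  by (simp add: algebra_simps)

lemma F_h_\<alpha>_le:
  assumes "0 < y" "1 \<le> \<tau> * y"
  shows "F (h y) \<le> \<alpha> + pi"
  using F_le[OF h(3)[of y] is_dir_add_pi[OF is_dir_\<alpha>]] h(1,2)[of y] angles assms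
  by (simp add: algebra_simps)

lemma F_h_\<alpha>_ge:
  assumes "0 < y" "\<tau> * y \<le> 1"
  shows "\<alpha> + pi \<le> F (h y)"
  using F_ge[OF h(3)[of y] is_dir_add_pi[OF is_dir_\<alpha>]] h(1,2)[of y] angles pos assms
  by (simp add: algebra_simps)

lemma F_mono: "x \<le> y \<Longrightarrow> F x \<le> F y"
  using triangle_lift_properties(3)[OF ball] by (rule monoD)

lemma F_add_pi: "F (x + pi) = F x + pi"
  by (rule triangle_lift_properties(5)[OF ball])

lemma F_add_2pi: "F (x + 2 * pi) = F x + 2 * pi"
proof -
  have "x + 2 * pi = x + pi + pi" by simp
  then show ?thesis by (simp only: F_add_pi)
qed

section \<open>Fifth iterates at the test points\<close>

lemma F5: "(F ^^ 5) x = F (F (F (F (F x))))"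
  by (simp add: eval_nat_numeral)

lemma F_chain_le:
  assumes "F x0 \<le> x1" "F x1 \<le> x2" "F x2 \<le> x3" "F x3 \<le> x4" "F x4 \<le> x5"
  shows "(F ^^ 5) x0 \<le> x5"
  unfolding F5
  by (intro order_trans[OF F_mono assms(5)] order_trans[OF F_mono assms(4)]
      order_trans[OF F_mono assms(3)] order_trans[OF F_mono assms(2)] assms(1))

lemma F_chain_ge:
  assumes "x1 \<le> F x0" "x2 \<le> F x1" "x3 \<le> F x2" "x4 \<le> F x3" "x5 \<le> F x4"
  shows "x5 \<le> (F ^^ 5) x0"
  unfolding F5
  by (intro order_trans[OF assms(5) F_mono] order_trans[OF assms(4) F_mono]
      order_trans[OF assms(3) F_mono] order_trans[OF assms(2) F_mono] assms(1))

text \<open>The coordinates visited are 0, infinity, - \<tau>, m / \<tau>, - \<tau> / u^2. The final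
  step by R reaches \<alpha> in time iff \<tau> * (\<tau> / u^2) is at least 1.\<close>

lemma F5_\<alpha>_le:
  assumes "u \<le> \<tau>" shows "(F ^^ 5) \<alpha> \<le> \<alpha> + 2 * pi"
proof (rule F_chain_le)
  show "F \<alpha> \<le> \<beta>" "F \<beta> \<le> h \<tau>" by (simp_all add: F_\<alpha> F_\<beta>)
  show "F (h \<tau>) \<le> g (m / \<tau>) + pi" using \<tau> pos by (intro F_h_le) auto
  show "F (g (m / \<tau>) + pi) \<le> h (\<tau> / u\<^sup>2) + pi"
    using F_g_le[of "m / \<tau>" "\<tau> / u\<^sup>2"] \<tau> pos u by (simp add: F_add_pi)
  have "u\<^sup>2 \<le> \<tau>\<^sup>2" using assms u by (intro power_mono) auto
  then show "F (h (\<tau> / u\<^sup>2) + pi) \<le> \<alpha> + 2 * pi"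
    using F_h_\<alpha>_le[of "\<tau> / u\<^sup>2"] \<tau> u by (simp add: F_add_pi power2_eq_square)
qed

text \<open>The fourth target cannot stay at \<open>h (\<tau> / u\<^sup>2)\<close>, since R may
  intervene earlier. The weaker target \<open>h (1 / \<tau>)\<close> is the direction that R sends
  exactly to \<alpha> + pi; it is not later, because \<tau> \<le> u and \<open>h\<close> is
  decreasing.\<close>

lemma F5_\<alpha>_ge:
  assumes "\<tau> \<le> u" shows "\<alpha> + 2 * pi \<le> (F ^^ 5) \<alpha>"
proof (rule F_chain_ge)
  have sq: "\<tau>\<^sup>2 \<le> u\<^sup>2" using assms \<tau> by (intro power_mono) auto
  have sq1: "\<tau>\<^sup>2 \<le> 1" using \<tau> by (simp add: power_le_one)
  show "\<beta> \<le> F \<alpha>" "h \<tau> \<le> F \<beta>" by (simp_all add: F_\<alpha> F_\<beta>)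
  show "g (m / \<tau>) + pi \<le> F (h \<tau>)"
    using \<tau> pos sq1 by (intro F_h_ge) (auto simp: field_simps power2_eq_square)
  have "h (1 / \<tau>) \<le> F (g (m / \<tau>))"
  proof (rule F_g_ge)
    show "m / u\<^sup>2 \<le> m / \<tau> * (1 / \<tau>)"
      using frac_le[OF _ order_refl _ sq, of m] \<tau> pos by (simp add: power2_eq_square)
    have "m \<le> m / \<tau>\<^sup>2" using sq1 \<tau> pos by (simp add: le_divide_eq mult_le_cancel_left1)
    then show "1 \<le> m / \<tau> * (1 / \<tau>) + \<tau> * (1 / \<tau> - m / \<tau>)"
      using \<tau> by (simp add: right_diff_distrib power2_eq_square)
  qed (use \<tau> pos in auto)
  then show "h (1 / \<tau>) + pi \<le> F (g (m / \<tau>) + pi)" by (simp add: F_add_pi)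
  show "\<alpha> + 2 * pi \<le> F (h (1 / \<tau>) + pi)"
    using F_h_\<alpha>_ge[of "1 / \<tau>"] \<tau> by (simp add: F_add_pi)
qed

text \<open>Since F is a minimum, any word in the three involutions bounds it from above; the word
  R, P, Q, P, Q returns to - 1 / u^2 exactly when \<tau> (1 + u^4) = 2 u^2.\<close>

lemma F5_le:
  assumes "2 * u\<^sup>2 \<le> \<tau> * (1 + u ^ 4)"
  shows "(F ^^ 5) (h (1 / u\<^sup>2)) \<le> h (1 / u\<^sup>2) + 2 * pi"
proof (rule F_chain_le)
  define v where "v = u\<^sup>2"
  have v: "0 < v" "v < 1" using u by (simp_all add: v_def power_less_one_iff)
  have \<tau>v: "2 * v \<le> \<tau> * (1 + v * v)" using assms by (simp add: v_def mult.assoc power2_eq_square eval_nat_numeral)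
  \<comment> \<open>P, Q, P, Q multiply y by 1 / v^2, so R has to send y to v^2 y or earlier, that
    is 1 + v^2 y^2 \<le> \<tau> (1 + v^2) y. The least \<tau> allowing this occurs at y = 1 / v, by
    the inequality of the means.\<close>
  show "F (h (1 / u\<^sup>2)) \<le> h v"
  proof (rule F_h_h_le)
    show "v < 1 / u\<^sup>2" using v unfolding v_def[symmetric]
      by (simp add: less_divide_eq) (metis mult_strict_mono less_eq_real_def mult_1 zero_less_one)
    show "1 + 1 / u\<^sup>2 * v \<le> \<tau> * (1 / u\<^sup>2 + v)" using v \<tau>v unfolding v_def[symmetric]
      by (simp add: field_simps)
  qed (use v in auto)
  show "F (h v) \<le> g (m / v) + pi" using v pos by (intro F_h_le) auto
  show "F (g (m / v) + pi) \<le> h 1 + pi"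
    using F_g_le[of "m / v" 1] v pos by (simp add: F_add_pi v_def)
  show "F (h 1 + pi) \<le> g m + 2 * pi"
    using F_h_le[of m 1] pos by (simp add: F_add_pi)
  show "F (g m + 2 * pi) \<le> h (1 / u\<^sup>2) + 2 * pi"
    using F_g_le[of m "1 / u\<^sup>2"] pos u by (simp add: F_add_2pi)
qed

text \<open>The directions - e and f are the ends of the chord PR.\<close>

lemma PR_chord_ends:
  obtains e f where "0 < e" "0 < f" "e * f = m" "1 = m + \<tau> * (e - f)" "\<tau> \<le> e"
proof -
  \<comment> \<open>Eliminating f = e + b / \<tau> from e f = m gives \<tau> e^2 + b e - \<tau> m =
    0; \<open>D\<close> is the root of its discriminant.\<close>
  define b where "b = m - 1"
  define D where "D = sqrt (b\<^sup>2 + 4 * \<tau>\<^sup>2 * m)"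
  have D2: "D\<^sup>2 = b\<^sup>2 + 4 * \<tau>\<^sup>2 * m" using pos by (simp add: D_def)
  have "\<bar>b\<bar> < D" using pos \<tau> by (auto simp: D_def intro!: real_less_rsqrt)
  then have D: "0 < D + b" "0 < D - b" by auto
  define e f where "e = (D - b) / (2 * \<tau>)" and "f = (D + b) / (2 * \<tau>)"
  have ef: "0 < e" "0 < f" using D \<tau> by (auto simp: e_def f_def)
  have "(D - b) * (D + b) = 4 * \<tau>\<^sup>2 * m" using D2 by (simp add: power2_eq_square algebra_simps)
  then have prod: "e * f = m" using \<tau> by (simp add: e_def f_def power2_eq_square)
  have "\<tau> * e = (D - b) / 2" "\<tau> * f = (D + b) / 2" using \<tau> by (simp_all add: e_def f_def)
  then have lin: "1 = m + \<tau> * (e - f)" by (simp add: b_def right_diff_distrib field_simps)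
  have "e * (f + \<tau>) = 1 + \<tau> * f" using prod lin by (simp add: algebra_simps)
  moreover have "\<tau> * (f + \<tau>) \<le> 1 + \<tau> * f"
    using \<tau> mult_le_one[of \<tau> \<tau>] by (simp add: algebra_simps)
  ultimately have "\<tau> \<le> e" using ef \<tau> by (metis add_pos_pos mult_le_cancel_right_pos)
  then show thesis using that ef prod lin by blast
qed

text \<open>The word is P, Q, R, P, Q, a cyclic shift of the one used for \<open>F5_le\<close>. The
  first step is a tie of P and R; in the steps by P and Q that follow, the condition of R is this
  equality relaxed in the right direction. The hypothesis enters in the middle step by R, together
  with 2 e \<le> 1 + e^2.\<close>

lemma F5_ge:
  assumes "\<tau> * (1 + u ^ 4) \<le> 2 * u\<^sup>2"
  obtains \<theta> where "\<theta> + 2 * pi \<le> (F ^^ 5) \<theta>"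
proof -
  define v where "v = u\<^sup>2"
  have v: "0 < v" "v < 1" using u by (simp_all add: v_def power_less_one_iff)
  have \<tau>v: "\<tau> * (1 + v * v) \<le> 2 * v" using assms by (simp add: v_def mult.assoc power2_eq_square eval_nat_numeral)
  obtain e f where ef: "0 < e" "0 < f" "e * f = m" "1 = m + \<tau> * (e - f)" "\<tau> \<le> e"
    by (rule PR_chord_ends)
  have ve: "0 < e * v" "e * v < e" "e < e / v" "f < f / v" using v ef by (simp_all add: less_divide_eq)
  have "h e + 2 * pi \<le> (F ^^ 5) (h e)"
  proof (rule F_chain_ge)
    show "g f + pi \<le> F (h e)"
      using ef by (intro F_h_ge) (auto simp: algebra_simps)
    have "h (e / v) \<le> F (g f)"
    proof (rule F_g_ge)
      show "m / u\<^sup>2 \<le> f * (e / v)" using ef by (simp add: v_def mult.commute)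
      have "m \<le> m / v" using m_le by (simp add: v_def)
      moreover have "\<tau> * e \<le> \<tau> * (e / v)" using \<tau> ve by (intro mult_left_mono) auto
      ultimately show "1 \<le> f * (e / v) + \<tau> * (e / v - f)"
        using ef by (simp add: right_diff_distrib mult.commute)
    qed (use ef v in auto)
    then show "h (e / v) + pi \<le> F (g f + pi)" by (simp add: F_add_pi)
    have "h (e * v) \<le> F (h (e / v))"
    proof (rule F_h_h_ge)
      have "\<tau> * (e / v + e * v) = \<tau> * (1 + v * v) * e / v" using v by (simp add: field_simps)
      also have "\<dots> \<le> 2 * v * e / v"
        using \<tau>v v ef by (intro divide_right_mono mult_right_mono) auto
      also have "\<dots> = 2 * e" using v by simp
      also have "\<dots> \<le> 1 + e * e" using sum_squares_ge_zero[of "e - 1" 0] by (simp add: algebra_simps)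
      finally show "\<tau> * (e / v + e * v) \<le> 1 + e / v * (e * v)" using v by simp
    qed (use ve in auto)
    then show "h (e * v) + pi \<le> F (h (e / v) + pi)" by (simp add: F_add_pi)
    have "g (f / v) + pi \<le> F (h (e * v))"
    proof (rule F_h_ge)
      have fe: "f / v * (e * v) = m" using v ef by (simp add: mult.commute)
      then show "f / v * (e * v) \<le> m" by simp
      have "\<tau> * (f - e) \<le> \<tau> * (f / v - e * v)" using \<tau> ve by (intro mult_left_mono) auto
      then show "0 \<le> 1 - f / v * (e * v) + \<tau> * (f / v - e * v)"
        unfolding fe using ef(4) by (simp add: algebra_simps)
    qed (use ef v in auto)
    then show "g (f / v) + 2 * pi \<le> F (h (e * v) + pi)" by (simp add: F_add_pi)
    have "h e \<le> F (g (f / v))"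
    proof (rule F_g_ge)
      show "m / u\<^sup>2 \<le> f / v * e" using ef by (simp add: v_def mult.commute)
      \<comment> \<open>The condition of R is affine in y and vanishes at y = f, because e and f are
        the ends of a chord through R; its slope is nonnegative by \<tau> \<le> e.\<close>
      have "y * e + \<tau> * (e - y) - 1 = (y - f) * (e - \<tau>)" for y
        using ef(3,4) by (simp add: algebra_simps)
      then have "f / v * e + \<tau> * (e - f / v) - 1 = (f / v - f) * (e - \<tau>)" .
      also have "\<dots> \<ge> 0" using ef ve by simp
      finally show "1 \<le> f / v * e + \<tau> * (e - f / v)" by simp
    qed (use ef v in auto)
    then show "h e + 2 * pi \<le> F (g (f / v) + 2 * pi)"
      by (simp add: F_add_2pi)
  qed
  then show thesis using that by blast
qed

end

section \<open>Hyperbolic distances in the Klein model\<close>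

lemma collinear_iff_cross:
  assumes "P \<noteq> Q"
  shows "cross P Q v = 0 \<longleftrightarrow> (\<exists>s. v = P + of_real s * (Q - P))"
proof
  assume c: "cross P Q v = 0"
  have "cnj (Q - P) * (v - P) = of_real (Re (cnj (Q - P) * (v - P)))"
    using c by (simp add: cross_def complex_eq_iff)
  then have "(Q - P) * cnj (Q - P) * (v - P) = of_real (Re (cnj (Q - P) * (v - P))) * (Q - P)"
    by (simp add: mult.assoc mult.commute)
  then have "of_real ((norm (Q - P))\<^sup>2) * (v - P) = of_real (Re (cnj (Q - P) * (v - P))) * (Q - P)"
    by (simp only: complex_norm_square)
  then have "v - P = of_real (Re (cnj (Q - P) * (v - P)) / (norm (Q - P))\<^sup>2) * (Q - P)"
    using assms by (simp add: field_simps)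
  then show "\<exists>s. v = P + of_real s * (Q - P)"
    by (metis add.commute diff_add_cancel)
next
  assume "\<exists>s. v = P + of_real s * (Q - P)"
  then obtain s where "v - P = of_real s * (Q - P)" by (metis add_diff_cancel_left')
  then show "cross P Q v = 0" by (simp add: cross_def) (simp add: algebra_simps)
qed

text \<open>One minus the inner product is the Lorentz form of the points lifted to height 1. The
  ends of the chord lift to null vectors, so only mixed terms survive.\<close>

lemma inner_chord_points:
  fixes v1 v2 :: complex
  assumes "norm v1 = 1" "norm v2 = 1"
  shows "1 - inner (of_real (1 - s) * v1 + of_real s * v2) (of_real (1 - t) * v1 + of_real t * v2)
    = ((1 - s) * t + s * (1 - t)) * (1 - inner v1 v2)"
proof -
  have 1: "inner v1 v1 = 1" "inner v2 v2 = 1" using assms by (simp_all add: dot_square_norm)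
  show ?thesis
    unfolding scaleR_conv_of_real[symmetric] inner_add_left inner_add_right
    by (simp add: 1 inner_commute[of v2 v1]) (simp add: algebra_simps)
qed

lemma inner_unit_less_1:
  fixes v1 v2 :: complex
  assumes "norm v1 = 1" "norm v2 = 1" "v1 \<noteq> v2"
  shows "inner v1 v2 < 1"
proof -
  have "0 < (norm (v1 - v2))\<^sup>2" using assms by simp
  also have "\<dots> = 2 - 2 * inner v1 v2"
    using assms(1,2)
    by (simp add: power2_norm_eq_inner inner_diff_left inner_diff_right inner_commute[of v2 v1] norm_eq_1)
  finally show ?thesis by simp
qed

lemma chord_point_in_disk_iff:
  fixes v1 v2 :: complex
  assumes "norm v1 = 1" "norm v2 = 1" "v1 \<noteq> v2"
  shows "norm (of_real (1 - s) * v1 + of_real s * v2) < 1 \<longleftrightarrow> 0 < s \<and> s < 1"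
proof -
  let ?x = "of_real (1 - s) * v1 + of_real s * v2"
  have "norm ?x < 1 \<longleftrightarrow> 0 < 1 - inner ?x ?x"
    by (simp add: dot_square_norm abs_square_less_1)
  also have "\<dots> \<longleftrightarrow> 0 < s * (1 - s)"
    using inner_chord_points[OF assms(1,2), of s s] inner_unit_less_1[OF assms]
    by (simp add: zero_less_mult_iff mult.commute)
  also have "\<dots> \<longleftrightarrow> 0 < s \<and> s < 1" by (auto simp: zero_less_mult_iff)
  finally show ?thesis .
qed

lemma line_point_affine:
  fixes P V :: complex
  assumes "a \<noteq> b"
  shows "P + of_real s * V = of_real (1 - (s - a) / (b - a)) * (P + of_real a * V)
    + of_real ((s - a) / (b - a)) * (P + of_real b * V)"
proof -
  define c where "c = (s - a) / (b - a)"
  have c: "s = a + c * (b - a)" using assms by (simp add: c_def)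
  show ?thesis unfolding c_def[symmetric] unfolding c by (simp add: algebra_simps)
qed

lemma chord_through:
  fixes P Q :: complex
  assumes "norm P < 1" "norm Q < 1" "P \<noteq> Q"
  obtains v1 v2 l m where "norm v1 = 1" "norm v2 = 1" "v1 \<noteq> v2" "0 < l" "l < m" "m < 1"
    "P = of_real (1 - l) * v1 + of_real l * v2" "Q = of_real (1 - m) * v1 + of_real m * v2"
proof -
  define f where "f s = norm (P + of_real s * (Q - P))" for s
  have cont: "continuous_on S f" for S unfolding f_def by (intro continuous_intros)
  \<comment> \<open>At parameters of absolute value \<open>T\<close> the point is at distance 2 from
    P, hence outside the disk.\<close>
  define T where "T = 2 / norm (Q - P)"
  have T: "T > 0" using assms by (simp add: T_def)
  have big: "1 \<le> f s" if "\<bar>s\<bar> = T" for s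
  proof -
    have "norm (of_real s * (Q - P)) = 2" using that assms by (simp add: norm_mult T_def)
    then show ?thesis
      using norm_triangle_ineq4[of "P + of_real s * (Q - P)" P] assms by (simp add: f_def)
  qed
  have f0: "f 0 < 1" "f 1 < 1" using assms by (simp_all add: f_def)
  have "\<exists>s\<ge>0. s \<le> T \<and> f s = 1"
    using IVT'[of f 0 1 T] f0 big[of T] T cont by force
  then obtain b where b: "0 \<le> b" "f b = 1" by blast
  have "\<exists>s\<ge>- T. s \<le> 0 \<and> f s = 1"
    using IVT2'[of f 0 1 "- T"] f0 big[of "- T"] T cont by force
  then obtain a where a: "a \<le> 0" "f a = 1" by blast
  have "a \<noteq> 0" "b \<noteq> 0" using a b f0 by auto
  then have ab: "a < 0" "0 < b" using a b by auto
  define v1 v2 where "v1 = P + of_real a * (Q - P)" and "v2 = P + of_real b * (Q - P)"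
  have unit: "norm v1 = 1" "norm v2 = 1" using a b by (simp_all add: v1_def v2_def f_def)
  have ne: "v1 \<noteq> v2" using ab assms by (auto simp: v1_def v2_def)
  define l m where "l = - a / (b - a)" and "m = (1 - a) / (b - a)"
  note pt = line_point_affine[of a b P _ "Q - P"]
  have P: "P = of_real (1 - l) * v1 + of_real l * v2" using pt[of 0] ab by (simp add: l_def v1_def v2_def)
  have Q: "Q = of_real (1 - m) * v1 + of_real m * v2" using pt[of 1] ab by (simp add: m_def v1_def v2_def)
  have "m < 1" using chord_point_in_disk_iff[OF unit ne, of m] Q assms by simp
  moreover have "0 < l" using ab by (simp add: l_def divide_neg_pos)
  moreover have "l < m" using ab unfolding l_def m_def by (intro divide_strict_right_mono) auto
  ultimately show thesis using that unit ne P Q by blast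
qed

lemma chord_point_of_collinear:
  fixes v1 v2 P Q S :: complex
  assumes "P = of_real (1 - l) * v1 + of_real l * v2" "Q = of_real (1 - m) * v1 + of_real m * v2"
    and "l \<noteq> m" "v1 \<noteq> v2"
  shows "cross P Q S = 0 \<longleftrightarrow> (\<exists>s. S = of_real (1 - s) * v1 + of_real s * v2)"
proof -
  have QP: "Q - P = of_real (m - l) * (v2 - v1)" unfolding assms(1,2) by (simp add: algebra_simps)
  then have ne: "P \<noteq> Q" using assms(3,4) by auto
  have 1: "P + of_real s * (Q - P) = of_real (1 - (l + s * (m - l))) * v1 + of_real (l + s * (m - l)) * v2" for s
    unfolding QP unfolding assms(1) by (simp add: algebra_simps)
  have "(\<exists>s. S = P + of_real s * (Q - P)) \<longleftrightarrow> (\<exists>s. S = of_real (1 - s) * v1 + of_real s * v2)"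
  proof (intro iffI; elim exE)
    fix s assume "S = P + of_real s * (Q - P)"
    then show "\<exists>s. S = of_real (1 - s) * v1 + of_real s * v2" unfolding 1 by blast
  next
    fix s assume "S = of_real (1 - s) * v1 + of_real s * v2"
    then have "S = P + of_real ((s - l) / (m - l)) * (Q - P)" using assms(3) unfolding 1 by simp
    then show "\<exists>s. S = P + of_real s * (Q - P)" by blast
  qed
  then show ?thesis using collinear_iff_cross[OF ne] by simp
qed

lemma cosh_half_abs_ln_sq:
  fixes X :: real
  assumes "0 < X" shows "(cosh ((1 / 2) * \<bar>ln X\<bar>))\<^sup>2 = (X + 1)\<^sup>2 / (4 * X)"
proof -
  have "(cosh ((1 / 2) * \<bar>ln X\<bar>))\<^sup>2 = (cosh (2 * ((1 / 2) * \<bar>ln X\<bar>)) + 1) / 2"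
    by (subst cosh_double_cosh) simp
  also have "cosh (2 * ((1 / 2) * \<bar>ln X\<bar>)) = cosh (ln X)" by (simp add: abs_if)
  also have "\<dots> = (X + inverse X) / 2" using assms by (rule cosh_ln_real)
  finally show ?thesis using assms by (simp add: field_simps power2_eq_square)
qed

lemma chord_cross_ratio_sq:
  fixes v1 v2 P Q :: complex
  assumes unit: "norm v1 = 1" "norm v2 = 1" and l: "0 < l" "l < 1" and m: "0 < m" "m < 1"
    and P: "P = of_real (1 - l) * v1 + of_real l * v2"
    and Q: "Q = of_real (1 - m) * v1 + of_real m * v2"
  shows "(m * (1 - l) / (l * (1 - m)) + 1)\<^sup>2 / (4 * (m * (1 - l) / (l * (1 - m))))
    * ((1 - (norm P)\<^sup>2) * (1 - (norm Q)\<^sup>2)) = (1 - inner P Q)\<^sup>2"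
proof -
  define X where "X = m * (1 - l) / (l * (1 - m))"
  have X: "X > 0" using l m by (simp add: X_def)
  define c where "c = 1 - inner v1 v2"
  have PQ: "1 - inner P Q = ((1 - l) * m + l * (1 - m)) * c"
    using inner_chord_points[OF unit, of l m, folded P Q] by (simp add: c_def)
  have PP: "1 - (norm P)\<^sup>2 = 2 * (l * (1 - l)) * c"
    using inner_chord_points[OF unit, of l l, folded P] by (simp add: c_def dot_square_norm mult.commute)
  have QQ: "1 - (norm Q)\<^sup>2 = 2 * (m * (1 - m)) * c"
    using inner_chord_points[OF unit, of m m, folded Q] by (simp add: c_def dot_square_norm mult.commute)
  have "(X + 1) * (l * (1 - m)) = (1 - l) * m + l * (1 - m)"
    using l m by (simp add: X_def field_simps)
  then have X1: "(X + 1)\<^sup>2 * (l * (1 - m))\<^sup>2 = ((1 - l) * m + l * (1 - m))\<^sup>2"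
    by (metis power_mult_distrib)
  have X2: "m * (1 - l) = X * (l * (1 - m))" using l m by (simp add: X_def)
  have "(X + 1)\<^sup>2 / (4 * X) * ((1 - (norm P)\<^sup>2) * (1 - (norm Q)\<^sup>2))
      = (X + 1)\<^sup>2 / (4 * X) * (4 * (m * (1 - l)) * (l * (1 - m)) * c\<^sup>2)"
    unfolding PP QQ by (simp add: power2_eq_square)
  also have "\<dots> = (X + 1)\<^sup>2 * (l * (1 - m))\<^sup>2 * c\<^sup>2"
    unfolding X2 using X by (simp add: power2_eq_square)
  also have "\<dots> = (1 - inner P Q)\<^sup>2" unfolding X1 PQ by (simp add: power_mult_distrib)
  finally show ?thesis unfolding X_def .
qed

lemma hdist_nonneg: "0 \<le> hdist P Q"
  by (simp add: hdist_def split: prod.splits)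

text \<open>The squared cosh is rational in the cross ratio and invariant under inverting it, so the
  unspecified order of the chosen chord ends disappears. Symmetry and minimization of the distance
  become algebra in P and Q.\<close>

lemma cosh_hdist_sq:
  assumes "norm P < 1" "norm Q < 1"
  shows "(cosh (hdist P Q))\<^sup>2 * ((1 - (norm P)\<^sup>2) * (1 - (norm Q)\<^sup>2)) = (1 - inner P Q)\<^sup>2"
proof (cases "P = Q")
  case True
  then show ?thesis by (simp add: hdist_def dot_square_norm power2_eq_square)
next
  case False
  have ex: "\<exists>v. case v of (v1, v2) \<Rightarrow> v1 \<noteq> v2 \<and> norm v1 = 1 \<and> norm v2 = 1
                         \<and> cross P Q v1 = 0 \<and> cross P Q v2 = 0"
  proof -
    obtain v1 v2 l m where *: "norm v1 = 1" "norm v2 = 1" "v1 \<noteq> v2" "0 < l" "l < m" "m < 1"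
      "P = of_real (1 - l) * v1 + of_real l * v2" "Q = of_real (1 - m) * v1 + of_real m * v2"
      by (rule chord_through[OF assms False])
    have lm: "l \<noteq> m" using * by simp
    have "cross P Q v1 = 0"
      unfolding chord_point_of_collinear[OF *(7,8) lm *(3)] by (rule exI[of _ 0]) simp
    moreover have "cross P Q v2 = 0"
      unfolding chord_point_of_collinear[OF *(7,8) lm *(3)] by (rule exI[of _ 1]) simp
    ultimately show ?thesis using * by blast
  qed
  obtain v1 v2 where v: "chord_ends P Q = (v1, v2)" by fastforce
  then have "v1 \<noteq> v2" and unit: "norm v1 = 1" "norm v2 = 1"
    and "cross P Q v1 = 0" "cross P Q v2 = 0"
    using someI_ex[OF ex] by (auto simp: chord_ends_def)
  then obtain a b where a: "v1 = P + of_real a * (Q - P)" and b: "v2 = P + of_real b * (Q - P)"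
    using collinear_iff_cross[OF False] by blast
  have ab: "a \<noteq> b" using \<open>v1 \<noteq> v2\<close> a b by auto
  define l m where "l = - a / (b - a)" and "m = (1 - a) / (b - a)"
  note pt = line_point_affine[of a b P _ "Q - P"]
  have P: "P = of_real (1 - l) * v1 + of_real l * v2" using pt[of 0] ab by (simp add: l_def a b)
  have Q: "Q = of_real (1 - m) * v1 + of_real m * v2" using pt[of 1] ab by (simp add: m_def a b)
  have l: "0 < l" "l < 1" using chord_point_in_disk_iff[OF unit \<open>v1 \<noteq> v2\<close>, of l] P assms by auto
  have m: "0 < m" "m < 1" using chord_point_in_disk_iff[OF unit \<open>v1 \<noteq> v2\<close>, of m] Q assms by auto
  define D where "D = norm (v2 - v1)"
  have D: "D > 0" using \<open>v1 \<noteq> v2\<close> by (simp add: D_def)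
  have n1: "norm ((of_real (1 - s) * v1 + of_real s * v2) - v1) = s * D"
    "norm ((of_real (1 - s) * v1 + of_real s * v2) - v2) = (1 - s) * D" if "0 < s" "s < 1" for s
  proof -
    have e1: "(of_real (1 - s) * v1 + of_real s * v2) - v1 = of_real s * (v2 - v1)"
      and e2: "(of_real (1 - s) * v1 + of_real s * v2) - v2 = of_real (1 - s) * (v1 - v2)"
      by (simp_all add: algebra_simps)
    show "norm ((of_real (1 - s) * v1 + of_real s * v2) - v1) = s * D"
      unfolding e1 D_def norm_mult norm_of_real using that by simp
    show "norm ((of_real (1 - s) * v1 + of_real s * v2) - v2) = (1 - s) * D"
      unfolding e2 D_def norm_mult norm_of_real using that by (simp add: norm_minus_commute)
  qed
  define X where "X = m * (1 - l) / (l * (1 - m))"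
  have X: "X > 0" using l m by (simp add: X_def)
  have "(norm (Q - v1) * norm (P - v2)) / (norm (P - v1) * norm (Q - v2)) = X"
    unfolding X_def n1[OF l, folded P] n1[OF m, folded Q] using D by simp
  then have hd: "hdist P Q = (1 / 2) * \<bar>ln X\<bar>" using False v by (simp add: hdist_def)
  show ?thesis
    unfolding hd cosh_half_abs_ln_sq[OF X] unfolding X_def
    using chord_cross_ratio_sq[OF unit l m P Q] .
qed

lemma cosh_sq_inj:
  fixes x y :: real
  assumes "0 \<le> x" "0 \<le> y" "(cosh x)\<^sup>2 = (cosh y)\<^sup>2"
  shows "x = y"
proof -
  have "cosh x = cosh y" using assms(3) by (simp add: power2_eq_iff_nonneg)
  then show ?thesis using assms(1,2) by simp
qed

lemma hdist_commute:
  assumes "norm P < 1" "norm Q < 1"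
  shows "hdist P Q = hdist Q P"
proof -
  have "(1 - (norm P)\<^sup>2) * (1 - (norm Q)\<^sup>2) \<noteq> 0"
    using assms by (simp add: abs_square_eq_1)
  then have "(cosh (hdist P Q))\<^sup>2 = (cosh (hdist Q P))\<^sup>2"
    using cosh_hdist_sq[OF assms] cosh_hdist_sq[OF assms(2,1)]
    by (metis inner_commute mult.commute mult_right_cancel)
  then show ?thesis using cosh_sq_inj hdist_nonneg by blast
qed

text \<open>Comparing squared cosh values avoids identifying the chosen ends with \<open>v1\<close>
  and \<open>v2\<close>.\<close>

lemma hdist_on_chord:
  fixes v1 v2 P Q :: complex
  assumes "norm v1 = 1" "norm v2 = 1" "v1 \<noteq> v2" "0 < l" "l < 1" "0 < m" "m < 1"
    and P: "P = of_real (1 - l) * v1 + of_real l * v2"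
    and Q: "Q = of_real (1 - m) * v1 + of_real m * v2"
  shows "hdist P Q = \<bar>ln (m * (1 - l) / (l * (1 - m)))\<bar> / 2"
proof -
  have ball: "norm P < 1" "norm Q < 1"
    using assms chord_point_in_disk_iff[OF assms(1-3)] by auto
  then have nz: "(1 - (norm P)\<^sup>2) * (1 - (norm Q)\<^sup>2) \<noteq> 0" by (simp add: abs_square_eq_1)
  have pos: "0 < m * (1 - l) / (l * (1 - m))" using assms by simp
  have "(cosh (hdist P Q))\<^sup>2 * ((1 - (norm P)\<^sup>2) * (1 - (norm Q)\<^sup>2))
      = (cosh (1 / 2 * \<bar>ln (m * (1 - l) / (l * (1 - m)))\<bar>))\<^sup>2
        * ((1 - (norm P)\<^sup>2) * (1 - (norm Q)\<^sup>2))"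
    unfolding cosh_half_abs_ln_sq[OF pos] cosh_hdist_sq[OF ball]
      chord_cross_ratio_sq[OF assms(1,2,4-)] ..
  then have "(cosh (hdist P Q))\<^sup>2 = (cosh (1 / 2 * \<bar>ln (m * (1 - l) / (l * (1 - m)))\<bar>))\<^sup>2"
    unfolding mult_right_cancel[OF nz] .
  then have "hdist P Q = 1 / 2 * \<bar>ln (m * (1 - l) / (l * (1 - m)))\<bar>"
    by (intro cosh_sq_inj[OF hdist_nonneg mult_nonneg_nonneg[OF _ abs_ge_zero]]) simp_all
  then show ?thesis by (simp only: times_divide_eq_left mult_1)
qed

lemma cross_swap_eq_0_iff: "cross Q P S = 0 \<longleftrightarrow> cross P Q S = 0"
  by (auto simp: cross_def algebra_simps)

lemma hdelta_commute: "hdelta Q P R = hdelta P Q R"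
  by (simp add: hdelta_def cross_swap_eq_0_iff)

lemma Delta'_commute:
  assumes "norm P < 1" "norm Q < 1" shows "Delta' n Q P = Delta' n P Q"
  by (simp add: Delta'_def hdist_commute[OF assms])

section \<open>Forms in the basis given by the ends of a chord\<close>

lemma chord_form_affine2:
  "chord_form (of_real (1 - s) * y + of_real s * z) v w
    = (1 - s) * chord_form y v w + s * chord_form z v w"
  by (simp add: chord_form_def algebra_simps)

lemma chord_form_bilinear:
  "chord_form z (of_real x * v + of_real y * w) (of_real x' * v + of_real y' * w)
    = x * x' * chord_form z v v + (x * y' + y * x') * chord_form z v w + y * y' * chord_form z w w"
  by (simp add: chord_form_def algebra_simps)

text \<open>A Gram determinant: the determinant 1 - |z|^2 of the form times the squared area spanned
  by \<open>v\<close> and \<open>w\<close>.\<close>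

lemma chord_form_det:
  "chord_form z v v * chord_form z w w - (chord_form z v w)\<^sup>2
    = (1 - (norm z)\<^sup>2) * (Im (cnj v * w))\<^sup>2"
  unfolding cmod_power2 by (simp add: chord_form_def algebra_simps power2_eq_square)

lemma chord_form_diag: "chord_form z (cis \<alpha>) (cis \<alpha>) = 1 - inner z (cis (2 * \<alpha>))"
  by (simp add: chord_form_cis inner_complex_def)

lemma chord_form_diag_pos:
  assumes "norm z < 1" shows "0 < chord_form z (cis \<alpha>) (cis \<alpha>)"
  using Re_one_minus_pos[OF assms, of "- (2 * \<alpha>)"] by (simp add: chord_form_cis)

text \<open>At a boundary point the form degenerates, with the half-angle vector in its kernel. By
  affinity, points of a chord have diagonal forms in the vectors of its two ends.\<close>

lemma chord_form_endpoint: "chord_form (cis (2 * \<alpha>)) (cis \<alpha>) (cis \<beta>) = 0"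
  by (simp add: chord_form_cis cis_mult cos_diff cos_add sin_diff)

lemma chord_form_opposite:
  "chord_form (cis (2 * \<beta>)) (cis \<alpha>) (cis \<alpha>) = 2 * (sin (\<beta> - \<alpha>))\<^sup>2"
proof -
  have "chord_form (cis (2 * \<beta>)) (cis \<alpha>) (cis \<alpha>) = 1 - cos (2 * (\<beta> - \<alpha>))"
    by (simp add: chord_form_cis cis_mult right_diff_distrib)
  then show ?thesis using cos_double_sin[of "\<beta> - \<alpha>"] by (simp add: right_diff_distrib)
qed

lemma chord_form_chord_point:
  fixes s \<alpha> \<beta> :: real
  defines "S \<equiv> of_real (1 - s) * cis (2 * \<alpha>) + of_real s * cis (2 * \<beta>)"
  shows "chord_form S (cis \<alpha>) (cis \<alpha>) = 2 * s * (sin (\<beta> - \<alpha>))\<^sup>2"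
    "chord_form S (cis \<beta>) (cis \<beta>) = 2 * (1 - s) * (sin (\<beta> - \<alpha>))\<^sup>2"
    "chord_form S (cis \<alpha>) (cis \<beta>) = 0"
proof -
  have "(sin (\<alpha> - \<beta>))\<^sup>2 = (sin (\<beta> - \<alpha>))\<^sup>2"
    by (metis minus_diff_eq power2_minus sin_minus)
  moreover have "chord_form (cis (2 * \<beta>)) (cis \<alpha>) (cis \<beta>) = 0"
    by (subst chord_form_commute) (rule chord_form_endpoint)
  ultimately show "chord_form S (cis \<alpha>) (cis \<alpha>) = 2 * s * (sin (\<beta> - \<alpha>))\<^sup>2"
    "chord_form S (cis \<beta>) (cis \<beta>) = 2 * (1 - s) * (sin (\<beta> - \<alpha>))\<^sup>2"
    "chord_form S (cis \<alpha>) (cis \<beta>) = 0"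
    unfolding S_def chord_form_affine2 chord_form_endpoint chord_form_opposite
    by simp_all
qed

lemma artanh_le_iff:
  fixes x y :: real
  assumes "- 1 < x" "x < 1" "- 1 < y" "y < 1"
  shows "artanh x \<le> artanh y \<longleftrightarrow> x \<le> y"
proof -
  have "artanh x \<le> artanh y \<longleftrightarrow> (1 + x) / (1 - x) \<le> (1 + y) / (1 - y)"
    using assms by (simp add: artanh_def)
  also have "\<dots> \<longleftrightarrow> x \<le> y" using assms by (simp add: divide_simps) (simp add: algebra_simps)
  finally show ?thesis .
qed

lemma artanh_double:
  fixes x :: real
  assumes "0 \<le> x" "x < 1"
  shows "2 * artanh x = artanh (2 * x / (1 + x\<^sup>2))"
proof -
  have p: "0 < 1 + x\<^sup>2" by (simp add: add_pos_nonneg)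
  have "1 + 2 * x / (1 + x\<^sup>2) = (1 + x)\<^sup>2 / (1 + x\<^sup>2)" "1 - 2 * x / (1 + x\<^sup>2) = (1 - x)\<^sup>2 / (1 + x\<^sup>2)"
    using p by (simp_all add: field_simps power2_eq_square)
  then have "(1 + 2 * x / (1 + x\<^sup>2)) / (1 - 2 * x / (1 + x\<^sup>2)) = (1 + x)\<^sup>2 / (1 - x)\<^sup>2"
    using p by simp
  also have "\<dots> = ((1 + x) / (1 - x))\<^sup>2" by (simp add: power_divide)
  finally show ?thesis using assms by (simp add: artanh_def ln_realpow)
qed

lemma cosh_artanh_sq:
  fixes x :: real
  assumes "0 \<le> x" "x < 1" shows "(cosh (artanh x))\<^sup>2 * (1 - x\<^sup>2) = 1"
proof -
  define X where "X = (1 + x) / (1 - x)"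
  have X: "1 \<le> X" using assms by (simp add: X_def)
  have "(cosh (artanh x))\<^sup>2 = (X + 1)\<^sup>2 / (4 * X)"
    using cosh_half_abs_ln_sq[of X] X by (simp add: artanh_def X_def[symmetric])
  also have "\<dots> * (1 - x\<^sup>2) = 1"
    using assms by (simp add: X_def divide_simps) (simp add: algebra_simps power2_eq_square)
  finally show ?thesis .
qed

text \<open>At chord parameter t the squared cosh of the distance from R is ((1 - t) r1 + t r2)^2 /
  (4 t (1 - t) (r1 r2 - r3^2)). By the inequality of the means its minimum is 1 / (1 - \<tau>^2), so
  \<tau> is the tanh of the distance.\<close>

lemma hdelta_eq_artanh:
  fixes P Q R :: complex and \<alpha> \<beta> l m :: real
  defines "r1 \<equiv> chord_form R (cis \<alpha>) (cis \<alpha>)" and "r2 \<equiv> chord_form R (cis \<beta>) (cis \<beta>)"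
    and "r3 \<equiv> chord_form R (cis \<alpha>) (cis \<beta>)"
  defines "\<tau> \<equiv> \<bar>r3\<bar> / sqrt (r1 * r2)"
  assumes angles: "\<alpha> < \<beta>" "\<beta> < \<alpha> + pi" and R: "norm R < 1" and lm: "l \<noteq> m"
    and P: "P = of_real (1 - l) * cis (2 * \<alpha>) + of_real l * cis (2 * \<beta>)"
    and Q: "Q = of_real (1 - m) * cis (2 * \<alpha>) + of_real m * cis (2 * \<beta>)"
  shows "hdelta P Q R = artanh \<tau>" "0 \<le> \<tau>" "\<tau> < 1"
proof -
  define s where "s = sin (\<beta> - \<alpha>)"
  have s: "0 < s" unfolding s_def using angles by (intro sin_gt_zero) auto
  have r: "0 < r1" "0 < r2" unfolding r1_def r2_def using chord_form_diag_pos[OF R] by auto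
  have "Im (cnj (cis \<alpha>) * cis \<beta>) = s" by (simp add: cis_cnj cis_mult s_def)
  then have det: "r1 * r2 - r3\<^sup>2 = (1 - (norm R)\<^sup>2) * s\<^sup>2"
    using chord_form_det[of R "cis \<alpha>" "cis \<beta>"] by (simp add: r1_def r2_def r3_def)
  have R1: "0 < 1 - (norm R)\<^sup>2" using R by (simp add: abs_square_less_1)
  have \<tau>2: "\<tau>\<^sup>2 * (r1 * r2) = r3\<^sup>2" using r by (simp add: \<tau>_def power_divide)
  show \<tau>0: "0 \<le> \<tau>" using r by (simp add: \<tau>_def)
  have W: "r1 * r2 * (1 - \<tau>\<^sup>2) = (1 - (norm R)\<^sup>2) * s\<^sup>2"
    using det \<tau>2 by (simp add: algebra_simps)
  also have "\<dots> > 0" using R1 s by simp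
  finally have "0 < 1 - \<tau>\<^sup>2" by (rule zero_less_mult_pos[OF _ mult_pos_pos[OF r]])
  then have \<tau>2_less: "\<tau>\<^sup>2 < 1" by simp
  then show \<tau>1: "\<tau> < 1" using \<tau>2_less \<tau>0 by (simp add: abs_square_less_1)
  have unit: "norm (cis (2 * \<alpha>)) = 1" "norm (cis (2 * \<beta>)) = 1" by simp_all
  have inner: "1 - inner (cis (2 * \<alpha>)) (cis (2 * \<beta>)) = 2 * s\<^sup>2"
    using chord_form_diag[of "cis (2 * \<alpha>)" \<beta>] chord_form_opposite[of \<alpha> \<beta>]
    by (simp add: s_def) (metis minus_diff_eq power2_minus sin_minus)
  have ne: "cis (2 * \<alpha>) \<noteq> cis (2 * \<beta>)"
  proof
    assume "cis (2 * \<alpha>) = cis (2 * \<beta>)"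
    then have "inner (cis (2 * \<alpha>)) (cis (2 * \<beta>)) = 1" by (simp add: dot_square_norm)
    then show False using inner s by simp
  qed
  have cosh_eq: "(cosh (hdist R S))\<^sup>2 * (r1 * r2 * (1 - \<tau>\<^sup>2)) * (4 * t * (1 - t)) = ((1 - t) * r1 + t * r2)\<^sup>2"
    if "S = of_real (1 - t) * cis (2 * \<alpha>) + of_real t * cis (2 * \<beta>)" "norm S < 1" for S t
  proof -
    have "1 - (norm S)\<^sup>2 = 4 * t * (1 - t) * s\<^sup>2"
      using inner_chord_points[OF unit, of t t, folded that(1)] inner by (simp add: dot_square_norm)
    moreover have "1 - inner R S = (1 - t) * r1 + t * r2"
      unfolding that(1) r1_def r2_def chord_form_diag scaleR_conv_of_real[symmetric] inner_add_right
      by (simp add: algebra_simps)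
    ultimately show ?thesis using cosh_hdist_sq[OF R that(2)] unfolding W by (simp add: mult_ac)
  qed
  note collinear = chord_point_of_collinear[OF P Q lm ne]
  have cosh_a: "(cosh (artanh \<tau>))\<^sup>2 * (1 - \<tau>\<^sup>2) = 1" by (rule cosh_artanh_sq[OF \<tau>0 \<tau>1])
  have a0: "0 \<le> artanh \<tau>" using artanh_le_iff[of 0 \<tau>] \<tau>0 \<tau>1 by simp
  show "hdelta P Q R = artanh \<tau>"
    unfolding hdelta_def
  proof (rule cInf_eq_minimum)
    \<comment> \<open>The case of equality, (1 - t) r1 = t r2.\<close>
    define t where "t = r1 / (r1 + r2)"
    have t: "0 < t" "t < 1" using r by (simp_all add: t_def)
    have tr: "t * (r1 + r2) = r1" using r by (simp add: t_def)
    define S where "S = of_real (1 - t) * cis (2 * \<alpha>) + of_real t * cis (2 * \<beta>)"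
    have S: "norm S < 1" unfolding S_def using chord_point_in_disk_iff[OF unit ne] t by blast
    have eq: "(1 - t) * r1 = t * r2" using tr by (simp add: algebra_simps)
    have "((1 - t) * r1 + t * r2)\<^sup>2 = 4 * ((1 - t) * r1) * (t * r2)"
      unfolding eq by (simp add: power2_eq_square)
    then have "(cosh (hdist R S))\<^sup>2 * (1 - \<tau>\<^sup>2) * (r1 * r2 * (4 * t * (1 - t))) = 1 * (r1 * r2 * (4 * t * (1 - t)))"
      using cosh_eq[OF S_def S] by (simp add: mult_ac)
    then have "(cosh (hdist R S))\<^sup>2 * (1 - \<tau>\<^sup>2) = 1"
      using r t by (subst (asm) mult_right_cancel) auto
    then have "(cosh (artanh \<tau>))\<^sup>2 = (cosh (hdist R S))\<^sup>2"
      using cosh_a \<tau>2_less by (metis diff_gt_0_iff_gt less_irrefl mult_right_cancel)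
    then have "artanh \<tau> = hdist R S" by (rule cosh_sq_inj[OF a0 hdist_nonneg])
    moreover have "cross P Q S = 0" unfolding collinear S_def by blast
    ultimately show "artanh \<tau> \<in> {hdist R S |S. S \<in> ball 0 1 \<and> cross P Q S = 0}"
      using S by auto
  next
    fix x assume "x \<in> {hdist R S |S. S \<in> ball 0 1 \<and> cross P Q S = 0}"
    then obtain S t where S: "x = hdist R S" "norm S < 1"
      and St: "S = of_real (1 - t) * cis (2 * \<alpha>) + of_real t * cis (2 * \<beta>)"
      unfolding collinear by auto
    have t: "0 < t" "t < 1" using chord_point_in_disk_iff[OF unit ne, of t] S(2) St by auto
    have "4 * ((1 - t) * r1) * (t * r2) \<le> ((1 - t) * r1 + t * r2)\<^sup>2"
      using sum_squares_ge_zero[of "(1 - t) * r1 - t * r2" 0] by (simp add: algebra_simps power2_eq_square)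
    then have "1 * (r1 * r2 * (4 * t * (1 - t))) \<le> (cosh x)\<^sup>2 * (1 - \<tau>\<^sup>2) * (r1 * r2 * (4 * t * (1 - t)))"
      using cosh_eq[OF St S(2)] S(1) by (simp add: mult_ac)
    then have "1 \<le> (cosh x)\<^sup>2 * (1 - \<tau>\<^sup>2)"
      using r t by (subst (asm) mult_le_cancel_right_pos) auto
    then have "(cosh (artanh \<tau>))\<^sup>2 \<le> (cosh x)\<^sup>2"
      using cosh_a \<tau>2_less by (metis diff_gt_0_iff_gt mult_le_cancel_right_pos)
    then have "cosh (artanh \<tau>) \<le> cosh x" by (rule power2_le_imp_le) simp
    then show "artanh \<tau> \<le> x"
      using a0 hdist_nonneg[of R S] S(1) by (simp add: cosh_real_nonneg_le_iff)
  qed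
qed

text \<open>Cancelling the growing exponential turns the quotient into (1 + q) / (1 - q) with q =
  exp (- d)^n, and artanh is half its logarithm.\<close>

lemma Delta'_eq_artanh:
  assumes "0 < hdist P Q" "0 < n"
  shows "Delta' n P Q = 2 * artanh (exp (- hdist P Q) ^ n)"
proof -
  define y where "y = exp (real n * hdist P Q)"
  have y: "1 < y" using assms by (simp add: y_def)
  have "exp (- hdist P Q) ^ n = exp (- (real n * hdist P Q))" by (simp flip: exp_of_nat_mult)
  then have "exp (- hdist P Q) ^ n = 1 / y" by (simp add: y_def exp_minus inverse_eq_divide)
  moreover have "(1 + 1 / y) / (1 - 1 / y) = (y + 1) / (y - 1)" using y by (simp add: divide_simps)
  ultimately show ?thesis by (simp add: Delta'_def artanh_def y_def)
qed

section \<open>From the distance conditions to normalized coordinates\<close>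

lemma rotation_number_oriented:
  fixes P Q R :: complex
  assumes ball: "norm P < 1" "norm Q < 1" "norm R < 1" and "P \<noteq> Q" and left: "0 \<le> cross P Q R"
    and cond: "(Delta' 2 P Q \<le> hdelta P Q R \<and> hdelta P Q R \<le> Delta' 1 P Q / 2) \<or>
         (Delta' 1 P Q / 2 \<le> hdelta P Q R \<and> hdelta P Q R \<le> Delta' 2 P Q)"
  shows "(\<lambda>n. ((circle_lift (psi (convex hull {P, Q, R})) ^^ n) x - x) / real n) \<longlonglongrightarrow> 2 / 5"
proof -
  obtain v1 v2 l m where v: "norm v1 = 1" "norm v2 = 1" "v1 \<noteq> v2" and lm: "0 < l" "l < m" "m < 1"
    and P: "P = of_real (1 - l) * v1 + of_real l * v2" and Q: "Q = of_real (1 - m) * v1 + of_real m * v2"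
    by (rule chord_through[OF ball(1,2) \<open>P \<noteq> Q\<close>])
  define \<alpha> where "\<alpha> = Arg v1 / 2"
  have v1: "v1 = cis (2 * \<alpha>)" using v rcis_cmod_Arg[of v1] by (simp add: \<alpha>_def rcis_def)
  obtain \<beta> where v2: "v2 = cis (2 * \<beta>)" and angles: "\<alpha> < \<beta>" "\<beta> < \<alpha> + pi"
    using unit_point_half_angle[OF v(2), of \<alpha>] v(3) v1 by metis
  define s where "s = sin (\<beta> - \<alpha>)"
  have s: "0 < s" unfolding s_def using angles by (intro sin_gt_zero) auto
  define r1 r2 r3 where "r1 = chord_form R (cis \<alpha>) (cis \<alpha>)" and "r2 = chord_form R (cis \<beta>) (cis \<beta>)"
    and "r3 = chord_form R (cis \<alpha>) (cis \<beta>)"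
  have r: "0 < r1" "0 < r2" unfolding r1_def r2_def using chord_form_diag_pos[OF ball(3)] by auto
  define \<tau> where "\<tau> = \<bar>r3\<bar> / sqrt (r1 * r2)"
  have lm_ne: "l \<noteq> m" using lm by simp
  have delta: "hdelta P Q R = artanh \<tau>" and \<tau>: "0 \<le> \<tau>" "\<tau> < 1"
    using hdelta_eq_artanh[OF angles ball(3) lm_ne P[unfolded v1 v2] Q[unfolded v1 v2]]
    unfolding \<tau>_def r1_def r2_def r3_def by auto

  define X where "X = m * (1 - l) / (l * (1 - m))"
  have "l * (1 - m) < m * (1 - l)" using lm by (simp add: algebra_simps)
  then have X: "1 < X" using lm by (simp add: X_def)
  have hd: "hdist P Q = ln X / 2"
    using hdist_on_chord[OF v _ _ _ _ P Q] lm X by (simp add: X_def)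
  then have hd_pos: "0 < hdist P Q" using ln_gt_zero[OF X] by linarith
  define u where "u = exp (- hdist P Q)"
  have u: "0 < u" "u < 1" using hd_pos by (simp_all add: u_def)
  have "u\<^sup>2 = exp (- ln X)" by (simp add: u_def hd power2_eq_square flip: exp_add)
  then have u2: "u\<^sup>2 = 1 / X" using X by (simp add: exp_minus inverse_eq_divide)
  have v_bounds: "0 < u\<^sup>2" "u\<^sup>2 < 1" using u by (simp_all add: power_less_one_iff)
  define w where "w = 2 * u\<^sup>2 / (1 + u ^ 4)"
  have "0 < (1 - u\<^sup>2)\<^sup>2" using v_bounds by simp
  then have w1: "2 * u\<^sup>2 < 1 + u ^ 4" by (simp add: power2_eq_square algebra_simps eval_nat_numeral)
  have u4: "0 < 1 + u ^ 4" by (simp add: add_pos_nonneg)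
  have w: "0 < w" "w < 1" using v_bounds w1 u4 by (simp_all add: w_def)
  have D1: "Delta' 1 P Q / 2 = artanh u"
    using Delta'_eq_artanh[OF hd_pos, of 1] by (simp add: u_def)
  have "2 * artanh (u\<^sup>2) = artanh w"
    using artanh_double[of "u\<^sup>2"] v_bounds by (simp add: w_def flip: power_mult)
  then have D2: "Delta' 2 P Q = artanh w"
    using Delta'_eq_artanh[OF hd_pos, of 2] by (simp add: u_def)
  have cond': "(w \<le> \<tau> \<and> \<tau> \<le> u) \<or> (u \<le> \<tau> \<and> \<tau> \<le> w)"
    using cond u w \<tau> unfolding D1 D2 delta by (simp add: artanh_le_iff)
  \<comment> \<open>Both bounds are positive, so R is off the line PQ.\<close>
  then have \<tau>_pos: "0 < \<tau>" using u w by linarith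

  have QP: "Q - P = of_real (m - l) * (v2 - v1)" unfolding P Q by (simp add: algebra_simps)
  have "cross P Q R = (m - l) * cross v1 v2 R"
  proof -
    have RP: "R - P = (R - v1) - of_real l * (v2 - v1)" unfolding P by (simp add: algebra_simps)
    show ?thesis unfolding cross_def QP RP by (simp add: algebra_simps)
  qed
  then have "0 \<le> cross v1 v2 R" using left lm by (simp add: zero_le_mult_iff)
  then have "0 \<le> r3" using s unfolding v1 v2 cross_cis by (simp add: r3_def s_def zero_le_mult_iff)

  \<comment> \<open>With this scale both basis vectors have square \<open>r1\<close> under the form
    of R, and their mixed value is r1 * \<tau>.\<close>
  define k where "k = sqrt (r1 / r2)"
  have k: "0 < k" and k2: "k\<^sup>2 * r2 = r1" using r by (simp_all add: k_def)
  have kr3: "k * r3 = r1 * \<tau>"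
  proof -
    have "sqrt (r1 * r2) = k * r2" using r by (simp add: k_def real_sqrt_mult real_sqrt_divide field_simps)
    then have "\<tau> = r3 / (k * r2)" using \<open>0 \<le> r3\<close> by (simp add: \<tau>_def)
    then show ?thesis using k r by (simp add: power2_eq_square flip: k2)
  qed
  \<comment> \<open>The ratio of the diagonal entries of the form of P in the scaled basis; for Q
    the ratio is larger by the cross ratio X = 1 / u^2.\<close>
  define M where "M = l / ((1 - l) * k\<^sup>2)"
  have M: "0 < M" using lm k by (simp add: M_def)
  have Mu: "M / u\<^sup>2 = m / ((1 - m) * k\<^sup>2)" unfolding u2 M_def X_def using lm k by simp
  interpret normalized_triangle P Q R \<alpha> \<beta> k M u \<tau>
    "2 * (1 - l) * s\<^sup>2 * k\<^sup>2" "2 * (1 - m) * s\<^sup>2 * k\<^sup>2" r1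
    "\<lambda>\<xi> \<eta>. of_real \<xi> * cis \<alpha> + of_real (k * \<eta>) * cis \<beta>"
  proof unfold_locales
    fix \<xi> \<eta> \<xi>' \<eta>' :: real
    have a: "(1 - l) * k\<^sup>2 * M = l" using lm k by (simp add: M_def)
    have b: "(1 - m) * k\<^sup>2 * (M / u\<^sup>2) = m" using lm k unfolding Mu by simp
    show "chord_form P (of_real \<xi> * cis \<alpha> + of_real (k * \<eta>) * cis \<beta>) (of_real \<xi>' * cis \<alpha> + of_real (k * \<eta>') * cis \<beta>)
        = 2 * (1 - l) * s\<^sup>2 * k\<^sup>2 * (M * \<xi> * \<xi>' + \<eta> * \<eta>')"
      unfolding P v1 v2 chord_form_bilinear chord_form_chord_point s_def[symmetric]
      by (subst (1) a[symmetric]) (simp add: algebra_simps power2_eq_square)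
    show "chord_form Q (of_real \<xi> * cis \<alpha> + of_real (k * \<eta>) * cis \<beta>) (of_real \<xi>' * cis \<alpha> + of_real (k * \<eta>') * cis \<beta>)
        = 2 * (1 - m) * s\<^sup>2 * k\<^sup>2 * (M / u\<^sup>2 * \<xi> * \<xi>' + \<eta> * \<eta>')"
      unfolding Q v1 v2 chord_form_bilinear chord_form_chord_point s_def[symmetric]
      by (subst (1) b[symmetric]) (simp add: algebra_simps power2_eq_square)
    have "chord_form R (of_real \<xi> * cis \<alpha> + of_real (k * \<eta>) * cis \<beta>) (of_real \<xi>' * cis \<alpha> + of_real (k * \<eta>') * cis \<beta>)
        = \<xi> * \<xi>' * r1 + (\<xi> * \<eta>' + \<eta> * \<xi>') * (k * r3) + \<eta> * \<eta>' * (k\<^sup>2 * r2)"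
      unfolding chord_form_bilinear r1_def[symmetric] r2_def[symmetric] r3_def[symmetric]
      by (simp add: algebra_simps power2_eq_square)
    then show "chord_form R (of_real \<xi> * cis \<alpha> + of_real (k * \<eta>) * cis \<beta>) (of_real \<xi>' * cis \<alpha> + of_real (k * \<eta>') * cis \<beta>)
        = r1 * (\<xi> * \<xi>' + \<eta> * \<eta>' + \<tau> * (\<xi> * \<eta>' + \<eta> * \<xi>'))"
      unfolding kr3 k2 by (simp add: algebra_simps)
  qed (use ball angles k lm s r M u \<tau> \<tau>_pos in auto)
  from cond' show ?thesis
  proof
    assume "w \<le> \<tau> \<and> \<tau> \<le> u"
    then have "2 * u\<^sup>2 \<le> \<tau> * (1 + u ^ 4)" "\<tau> \<le> u" using u4 by (simp_all add: w_def divide_le_eq)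
    then show ?thesis using rotation_number_triangle[OF ball F5_le F5_\<alpha>_ge] by blast
  next
    assume "u \<le> \<tau> \<and> \<tau> \<le> w"
    then have "\<tau> * (1 + u ^ 4) \<le> 2 * u\<^sup>2" "u \<le> \<tau>" using u4 by (simp_all add: w_def le_divide_eq)
    then show ?thesis using rotation_number_triangle[OF ball F5_\<alpha>_le] F5_ge by blast
  qed
qed

theorem theorem4p9:
  fixes P Q R :: complex
  assumes "convex hull {P, Q, R} \<subseteq> ball 0 1"
    and "P \<noteq> Q"
    and "(Delta' 2 P Q \<le> hdelta P Q R \<and> hdelta P Q R \<le> Delta' 1 P Q / 2) \<or>
         (Delta' 1 P Q / 2 \<le> hdelta P Q R \<and> hdelta P Q R \<le> Delta' 2 P Q)"
  shows "\<forall>x. (\<lambda>n. ((circle_lift (psi (convex hull {P, Q, R})) ^^ n) x - x) / real n)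
              \<longlonglongrightarrow> 2 / 5"
proof
  fix x
  have "{P, Q, R} \<subseteq> ball 0 1" using assms(1) hull_subset[of "{P, Q, R}" convex] by blast
  then have ball: "norm P < 1" "norm Q < 1" "norm R < 1" by auto
  show "(\<lambda>n. ((circle_lift (psi (convex hull {P, Q, R})) ^^ n) x - x) / real n) \<longlonglongrightarrow> 2 / 5"
  proof (cases "0 \<le> cross P Q R")
    case True
    then show ?thesis by (rule rotation_number_oriented[OF ball assms(2) _ assms(3)])
  next
    case False
    \<comment> \<open>Exchanging P and Q reverses the orientation and preserves the hull and the
      hypotheses.\<close>
    have "cross Q P R = - cross P Q R" by (simp add: cross_def algebra_simps)
    then have "0 \<le> cross Q P R" using False by simp
    moreover have "{Q, P, R} = {P, Q, R}" by auto
    ultimately show ?thesis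
      using rotation_number_oriented[OF ball(2,1,3), of x] assms(2,3)
      by (simp add: hdelta_commute[of Q P] Delta'_commute[OF ball(1,2)])
  qed
qed

end
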